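(* Let $(\Gamma,f,m)$ be a Dyer graph with $\Gamma$ finite, let $D=D(\Gamma,f,m)$ be the associated Dyer group, let $\Lambda$ be the edge-labeled graph built from $(\Gamma,f,m)$ as described in the context, and let $W=W(\Lambda)$ be the associated Coxeter group. Let $k=|V_p\cup V_\infty|$ and let $\xi$ be the action of $(\mathbb{Z}/2\mathbb{Z})^{k}$ on $D$ by automorphisms described in the context. Then $$W(\Lambda)\;\cong\; D(\Gamma,f,m)\rtimes_{\xi}(\mathbb{Z}/2\mathbb{Z})^{k}.$$
   Context: Dyer graph: a triple $(\Gamma,f,m)$ where $\Gamma$ is a simplicial graph with vertex set $V$ and edge set $E$, and $f:V\to\mathbb{N}_{\ge 2}\cup\{\infty\}$, $m:E\to\mathbb{N}_{\ge 2}$ are maps such that $m(e)=2$ for every edge $e=\{v,w\}$ with $f(v)\ge 3$ (this includes $f(v)=\infty$). For $k\in\mathbb{N}$ write $[a,b]_k=\underbrace{aba\cdots}_{k}$ (alternating word of length $k$ starting with $a$). The Dyer group $D(\Gamma,f,m)$ is $$\langle x_v,\ v\in V\mid x_v^{f(v)}=1 \text{ if } f(v)\ne\infty,\ [x_v,x_u]_{m(e)}=[x_u,x_v]_{m(e)} \text{ for all } e=\{u,v\}\in E\rangle .$$ Put $V_2=\{v\in V: f(v)=2\}$, $V_\infty=\{v\in V: f(v)=\infty\}$, $V_p=V\setminus(V_2\cup V_\infty)$. The graph $\Lambda$: a simplicial graph with vertex set $V(\Lambda)=V\sqcup\{v' : v\in V_p\cup V_\infty\}$ and edge labeling $m'$.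 Two vertices $u,v\in V$ span an edge of $\Lambda$ iff they span an edge $e$ of $\Gamma$, and then $m'(e)=m(e)$. For all $u\in V_p\cup V_\infty$ and all $v\in V(\Lambda)\setminus\{u,u'\}$ there is an edge $\{u',v\}$ with label $2$. For all $u\in V_p$ there is an edge $\{u,u'\}$ with label $f(u)$. There are no other edges. The Coxeter group $W(\Lambda)$ is $\langle y_v,\ v\in V(\Lambda)\mid y_v^2=1 \text{ for all } v,\ (y_uy_v)^{m'(e)}=1 \text{ for all } e=\{u,v\}\in E(\Lambda)\rangle$. The action $\xi$: for $v\in V_p\cup V_\infty$, $\xi_v:D\to D$ is the homomorphism with $\xi_v(x_u)=x_u$ for $u\in V\setminus\{v\}$ and $\xi_v(x_v)=x_v^{-1}$. The $\xi_v$ are commuting automorphisms with $\xi_v^2=\mathrm{Id}$, so they define an action $\xi$ of $(\mathbb{Z}/2\mathbb{Z})^{|V_p\cup V_\infty|}$ on $D$, the generator indexed by $v$ acting by $\xi_v$. *)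

theory Defs
  imports "HOL-Algebra.Algebra" "HOL-Library.Extended_Nat"
begin

section \<open>Groups given by generators and relations\<close>

text \<open>The letter \<open>(s, True)\<close> stands for the generator \<open>s\<close>, the letter \<open>(s, False)\<close> for its inverse.
  A relation is a pair \<open>(r, r')\<close> of words, read as \<open>r = r'\<close>.\<close>

type_synonym 'a gword = "('a \<times> bool) list"

definition gwords :: "'a set \<Rightarrow> 'a gword set"
  where "gwords S = lists (S \<times> UNIV)"

inductive pres_eq :: "'a set \<Rightarrow> ('a gword \<times> 'a gword) set \<Rightarrow> 'a gword \<Rightarrow> 'a gword \<Rightarrow> bool"
  for S R where
  refl: "w \<in> gwords S \<Longrightarrow> pres_eq S R w w"
| sym: "pres_eq S R v w \<Longrightarrow> pres_eq S R w v"
| trans: "pres_eq S R u v \<Longrightarrow> pres_eq S R v w \<Longrightarrow> pres_eq S R u w"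
| cancel: "s \<in> S \<Longrightarrow> u \<in> gwords S \<Longrightarrow> v \<in> gwords S \<Longrightarrow>
    pres_eq S R (u @ [(s, b), (s, \<not> b)] @ v) (u @ v)"
| rel: "(r, r') \<in> R \<Longrightarrow> r \<in> gwords S \<Longrightarrow> r' \<in> gwords S \<Longrightarrow>
    u \<in> gwords S \<Longrightarrow> v \<in> gwords S \<Longrightarrow> pres_eq S R (u @ r @ v) (u @ r' @ v)"

definition pres_class :: "'a set \<Rightarrow> ('a gword \<times> 'a gword) set \<Rightarrow> 'a gword \<Rightarrow> 'a gword set"
  where "pres_class S R w = {w'. pres_eq S R w w'}"

definition presented_group :: "'a set \<Rightarrow> ('a gword \<times> 'a gword) set \<Rightarrow> 'a gword set monoid"
  where "presented_group S R =
    \<lparr>carrier = pres_class S R ` gwords S,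
     monoid.mult = (\<lambda>P Q. \<Union>x\<in>P. \<Union>y\<in>Q. pres_class S R (x @ y)),
     one = pres_class S R []\<rparr>"

definition pres_gen :: "'a set \<Rightarrow> ('a gword \<times> 'a gword) set \<Rightarrow> 'a \<Rightarrow> 'a gword set"
  where "pres_gen S R s = pres_class S R [(s, True)]"

definition word_eval :: "('b, 'c) monoid_scheme \<Rightarrow> ('a \<Rightarrow> 'b) \<Rightarrow> 'a gword \<Rightarrow> 'b"
  where "word_eval H \<phi> w =
    foldr (\<lambda>(s, b) y. (if b then \<phi> s else inv\<^bsub>H\<^esub> (\<phi> s)) \<otimes>\<^bsub>H\<^esub> y) w \<one>\<^bsub>H\<^esub>"

definition word_inv :: "'a gword \<Rightarrow> 'a gword"
  where "word_inv w = rev (map (\<lambda>(s, b). (s, \<not> b)) w)"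

lemma gwords_simps [simp]:
  "[] \<in> gwords S"
  "x # w \<in> gwords S \<longleftrightarrow> fst x \<in> S \<and> w \<in> gwords S"
  "v @ w \<in> gwords S \<longleftrightarrow> v \<in> gwords S \<and> w \<in> gwords S"
  by (cases x; auto simp: gwords_def)+

lemma word_inv_in [simp]: "word_inv w \<in> gwords S \<longleftrightarrow> w \<in> gwords S"
  by (induction w) (auto simp: word_inv_def)

lemma pres_eq_words: "pres_eq S R v w \<Longrightarrow> v \<in> gwords S \<and> w \<in> gwords S"
  by (induction rule: pres_eq.induct) auto

lemma pres_eq_context:
  assumes "pres_eq S R v w" "x \<in> gwords S" "y \<in> gwords S"
  shows "pres_eq S R (x @ v @ y) (x @ w @ y)"
  using assms(1)
proof (induction rule: pres_eq.induct)
  case (refl w) then show ?case using assms by (auto intro: pres_eq.refl)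
next
  case (sym v w) then show ?case by (blast intro: pres_eq.sym)
next
  case (trans u v w) then show ?case by (blast intro: pres_eq.trans)
next
  case (cancel s u v b)
  then show ?case using pres_eq.cancel[of s S "x @ u" "v @ y" R b] assms by simp
next
  case (rel r r' u v)
  then show ?case using pres_eq.rel[of r r' R S "x @ u" "v @ y"] assms by simp
qed

lemma pres_eq_append:
  assumes "pres_eq S R v v'" "pres_eq S R w w'"
  shows "pres_eq S R (v @ w) (v' @ w')"
proof -
  have "pres_eq S R (v @ w) (v' @ w)"
    using pres_eq_context[OF assms(1), of "[]" w] pres_eq_words[OF assms(2)] by simp
  moreover have "pres_eq S R (v' @ w) (v' @ w')"
    using pres_eq_context[OF assms(2), of v' "[]"] pres_eq_words[OF assms(1)] by simp
  ultimately show ?thesis by (rule pres_eq.trans)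
qed

lemma pres_eq_inv:
  assumes "w \<in> gwords S"
  shows "pres_eq S R (word_inv w @ w) []"
  using assms
proof (induction w)
  case Nil then show ?case by (auto simp: word_inv_def intro: pres_eq.refl)
next
  case (Cons x w)
  obtain s b where x: "x = (s, b)" by (cases x)
  have "pres_eq S R (word_inv w @ [(s, \<not> b), (s, \<not> \<not> b)] @ w) (word_inv w @ w)"
    by (rule pres_eq.cancel) (use Cons.prems x in auto)
  then have "pres_eq S R (word_inv (x # w) @ (x # w)) (word_inv w @ w)"
    by (simp add: x word_inv_def)
  then show ?case using Cons by (auto intro: pres_eq.trans)
qed

lemma pres_class_eq_iff:
  assumes "v \<in> gwords S"
  shows "pres_class S R v = pres_class S R w \<longleftrightarrow> pres_eq S R v w"
  using assms unfolding pres_class_def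
  by (auto intro: pres_eq.refl pres_eq.sym pres_eq.trans)

lemma carrier_presented:
  "carrier (presented_group S R) = pres_class S R ` gwords S"
  and one_presented: "\<one>\<^bsub>presented_group S R\<^esub> = pres_class S R []"
  by (simp_all add: presented_group_def)

lemma mult_presented:
  assumes "v \<in> gwords S" "w \<in> gwords S"
  shows "pres_class S R v \<otimes>\<^bsub>presented_group S R\<^esub> pres_class S R w = pres_class S R (v @ w)"
proof -
  have "pres_class S R (x @ y) = pres_class S R (v @ w)"
    if "x \<in> pres_class S R v" "y \<in> pres_class S R w" for x y
  proof -
    have "pres_eq S R (v @ w) (x @ y)"
      using that by (auto simp: pres_class_def intro: pres_eq_append)
    then show ?thesis using assms by (metis gwords_simps(3) pres_class_eq_iff)
  qed
  moreover have "v \<in> pres_class S R v" "w \<in> pres_class S R w"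
    using assms by (auto simp: pres_class_def intro: pres_eq.refl)
  ultimately have "(\<Union>x\<in>pres_class S R v. \<Union>y\<in>pres_class S R w. pres_class S R (x @ y))
      = pres_class S R (v @ w)" by blast
  then show ?thesis by (simp add: presented_group_def)
qed

lemma group_presented: "group (presented_group S R)"
proof (rule groupI)
  fix x assume "x \<in> carrier (presented_group S R)"
  then obtain w where w: "w \<in> gwords S" "x = pres_class S R w" by (auto simp: carrier_presented)
  then have "pres_class S R (word_inv w) \<otimes>\<^bsub>presented_group S R\<^esub> x = \<one>\<^bsub>presented_group S R\<^esub>"
    by (simp add: mult_presented one_presented pres_class_eq_iff pres_eq_inv)
  then show "\<exists>y\<in>carrier (presented_group S R).
      y \<otimes>\<^bsub>presented_group S R\<^esub> x = \<one>\<^bsub>presented_group S R\<^esub>"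
    using w by (auto simp: carrier_presented)
qed (auto simp: carrier_presented one_presented mult_presented)

lemma pres_gen_closed: "s \<in> S \<Longrightarrow> pres_gen S R s \<in> carrier (presented_group S R)"
  by (simp add: pres_gen_def carrier_presented)

lemma inv_pres_gen:
  assumes "s \<in> S"
  shows "inv\<^bsub>presented_group S R\<^esub> (pres_gen S R s) = pres_class S R [(s, False)]"
proof (rule group.inv_equality[OF group_presented])
  show "pres_class S R [(s, False)] \<otimes>\<^bsub>presented_group S R\<^esub> pres_gen S R s = \<one>\<^bsub>presented_group S R\<^esub>"
    using assms pres_eq.cancel[of s S "[]" "[]" R False]
    by (simp add: pres_gen_def mult_presented one_presented pres_class_eq_iff)
qed (use assms in \<open>auto simp: carrier_presented pres_gen_def\<close>)

context group
begin

lemma word_eval_closed [simp]: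
  assumes "\<phi> \<in> S \<rightarrow> carrier G" "w \<in> gwords S"
  shows "word_eval G \<phi> w \<in> carrier G"
  using assms(2)
proof (induction w)
  case (Cons x w)
  then have "\<phi> (fst x) \<in> carrier G" using assms(1) by auto
  then show ?case using Cons by (simp add: word_eval_def split_def)
qed (simp add: word_eval_def)

lemma word_eval_append:
  assumes "\<phi> \<in> S \<rightarrow> carrier G" "v \<in> gwords S" "w \<in> gwords S"
  shows "word_eval G \<phi> (v @ w) = word_eval G \<phi> v \<otimes> word_eval G \<phi> w"
  using assms(2)
proof (induction v)
  case Nil
  then show ?case using word_eval_closed[OF assms(1,3)] by (simp add: word_eval_def)
next
  case (Cons x v)
  have c: "word_eval G \<phi> v \<in> carrier G" "word_eval G \<phi> w \<in> carrier G"
    using assms Cons.prems word_eval_closed[OF assms(1)] by auto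
  have p: "\<phi> (fst x) \<in> carrier G" using assms Cons.prems by auto
  have "word_eval G \<phi> (x # u) = (if snd x then \<phi> (fst x) else inv \<phi> (fst x)) \<otimes> word_eval G \<phi> u"
    for u by (simp add: word_eval_def split_def)
  then show ?case using Cons c p by (simp add: m_assoc)
qed

lemma word_eval_pres_eq:
  assumes \<phi>: "\<phi> \<in> S \<rightarrow> carrier G"
    and R: "\<And>r r'. (r, r') \<in> R \<Longrightarrow> word_eval G \<phi> r = word_eval G \<phi> r'"
    and "pres_eq S R v w"
  shows "word_eval G \<phi> v = word_eval G \<phi> w"
  using assms(3)
proof (induction rule: pres_eq.induct)
  case (cancel s u v b)
  have "\<phi> s \<in> carrier G" using \<phi> cancel by auto
  then have "word_eval G \<phi> [(s, b), (s, \<not> b)] = \<one>"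
    by (auto simp: word_eval_def)
  moreover have "[(s, b), (s, \<not> b)] \<in> gwords S" using cancel by simp
  ultimately show ?case
    using cancel word_eval_closed[OF \<phi>] by (simp add: word_eval_append[OF \<phi>] del: append_Cons append_Nil)
next
  case (rel r r' u v)
  then show ?case by (simp add: word_eval_append[OF \<phi>] R)
qed auto

end

lemma pres_class_hom_eq:
  assumes "group H" "h \<in> hom (presented_group S R) H" "w \<in> gwords S"
  shows "h (pres_class S R w) = word_eval H (\<lambda>s. h (pres_gen S R s)) w"
proof -
  interpret P: group "presented_group S R" by (rule group_presented)
  interpret H: group H by fact
  interpret h: group_hom "presented_group S R" H h
    by (unfold_locales) (use assms in auto)
  show ?thesis using assms(3)
  proof (induction w)
    case Nil
    then show ?case using h.hom_one by (simp add: word_eval_def one_presented)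
  next
    case (Cons x w)
    obtain s b where x: "x = (s, b)" by (cases x)
    have s: "s \<in> S" "w \<in> gwords S" using Cons.prems x by auto
    have 1: "pres_class S R (x # w) = pres_class S R [x] \<otimes>\<^bsub>presented_group S R\<^esub> pres_class S R w"
      using s x by (simp add: mult_presented)
    have 2: "pres_class S R [x] =
        (if b then pres_gen S R s else inv\<^bsub>presented_group S R\<^esub> (pres_gen S R s))"
      using inv_pres_gen[OF s(1)] by (simp add: x pres_gen_def)
    have "h (pres_class S R (x # w)) = h (pres_class S R [x]) \<otimes>\<^bsub>H\<^esub> h (pres_class S R w)"
      unfolding 1 by (rule h.hom_mult) (use s x in \<open>auto simp: carrier_presented\<close>)
    moreover have "h (pres_class S R [x]) =
        (if b then h (pres_gen S R s) else inv\<^bsub>H\<^esub> (h (pres_gen S R s)))"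
      unfolding 2 using pres_gen_closed[OF s(1), of R] by simp
    ultimately show ?case
      using Cons.IH s by (simp add: word_eval_def x)
  qed
qed

lemma presented_group_hom_unique:
  assumes "group H" "h \<in> hom (presented_group S R) H" "h' \<in> hom (presented_group S R) H"
    and "h \<in> extensional (carrier (presented_group S R))"
    and "h' \<in> extensional (carrier (presented_group S R))"
    and eq: "\<And>s. s \<in> S \<Longrightarrow> h (pres_gen S R s) = h' (pres_gen S R s)"
  shows "h = h'"
proof (rule extensionalityI[OF assms(4,5)])
  fix x assume "x \<in> carrier (presented_group S R)"
  then obtain w where w: "w \<in> gwords S" "x = pres_class S R w" by (auto simp: carrier_presented)
  have "word_eval H (\<lambda>s. h (pres_gen S R s)) w = word_eval H (\<lambda>s. h' (pres_gen S R s)) w"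
    using w(1) by (induction w) (auto simp: word_eval_def eq)
  then show "h x = h' x"
    using pres_class_hom_eq[OF assms(1,2) w(1)] pres_class_hom_eq[OF assms(1,3) w(1)] w(2) by simp
qed

lemma presented_group_universal:
  assumes H: "group H" and \<phi>: "\<phi> \<in> S \<rightarrow> carrier H"
    and R: "\<And>r r'. (r, r') \<in> R \<Longrightarrow> word_eval H \<phi> r = word_eval H \<phi> r'"
  shows "\<exists>!h. h \<in> hom (presented_group S R) H \<and> h \<in> extensional (carrier (presented_group S R)) \<and>
    (\<forall>s\<in>S. h (pres_gen S R s) = \<phi> s)"
proof -
  interpret H: group H by fact
  define h where "h = (\<lambda>P\<in>carrier (presented_group S R). word_eval H \<phi> (SOME w. w \<in> P))"
  have h: "h (pres_class S R w) = word_eval H \<phi> w" if w: "w \<in> gwords S" for w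
  proof -
    have "w \<in> pres_class S R w" using w by (auto simp: pres_class_def intro: pres_eq.refl)
    then have "(SOME w'. w' \<in> pres_class S R w) \<in> pres_class S R w" by (rule someI)
    then have "pres_eq S R w (SOME w'. w' \<in> pres_class S R w)" by (simp add: pres_class_def)
    from H.word_eval_pres_eq[OF \<phi> R this] w show ?thesis
      by (simp add: h_def carrier_presented)
  qed
  have hom: "h \<in> hom (presented_group S R) H"
    by (rule homI)
      (auto simp: carrier_presented mult_presented h H.word_eval_append[OF \<phi>] H.word_eval_closed[OF \<phi>])
  have ext: "h \<in> extensional (carrier (presented_group S R))" by (simp add: h_def)
  have gen: "\<forall>s\<in>S. h (pres_gen S R s) = \<phi> s"
    using \<phi> by (auto simp: pres_gen_def h word_eval_def Pi_iff)
  show ?thesis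
    by (rule ex1I[of _ h])
      (use hom ext gen in \<open>auto intro!: presented_group_hom_unique[OF H]\<close>)
qed


section \<open>Semidirect products\<close>

definition semidirect :: "('a, 'c) monoid_scheme \<Rightarrow> ('b, 'd) monoid_scheme \<Rightarrow> ('b \<Rightarrow> 'a \<Rightarrow> 'a) \<Rightarrow> ('a \<times> 'b) monoid"
  where "semidirect N H \<phi> =
    \<lparr>carrier = carrier N \<times> carrier H,
     monoid.mult = (\<lambda>(n, h) (n', h'). (n \<otimes>\<^bsub>N\<^esub> \<phi> h n', h \<otimes>\<^bsub>H\<^esub> h')),
     one = (\<one>\<^bsub>N\<^esub>, \<one>\<^bsub>H\<^esub>)\<rparr>"

lemma AutoGroup_simps:
  shows carrier_AutoGroup: "carrier (AutoGroup G) = auto G"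
    and one_AutoGroup: "\<one>\<^bsub>AutoGroup G\<^esub> = (\<lambda>x\<in>carrier G. x)"
    and mult_AutoGroup: "g \<in> auto G \<Longrightarrow> h \<in> auto G \<Longrightarrow> g \<otimes>\<^bsub>AutoGroup G\<^esub> h = compose (carrier G) g h"
  by (simp_all add: AutoGroup_def BijGroup_def auto_def)

lemma group_semidirect:
  assumes "group N" "group H" and \<phi>: "\<phi> \<in> hom H (AutoGroup N)"
  shows "group (semidirect N H \<phi>)"
proof -
  interpret N: group N by fact
  interpret H: group H by fact
  interpret A: group "AutoGroup N" by (rule N.AutoGroup)
  interpret \<phi>: group_hom H "AutoGroup N" \<phi> by unfold_locales (use \<phi> in auto)
  have auto: "\<phi> h \<in> auto N" if "h \<in> carrier H" for h
    using \<phi>.hom_closed[OF that] by (simp add: carrier_AutoGroup)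
  have cl: "\<phi> h n \<in> carrier N" if "h \<in> carrier H" "n \<in> carrier N" for h n
    using auto[OF that(1)] that(2) by (auto simp: auto_def hom_def)
  have hom: "\<phi> h (n \<otimes>\<^bsub>N\<^esub> n') = \<phi> h n \<otimes>\<^bsub>N\<^esub> \<phi> h n'"
    if "h \<in> carrier H" "n \<in> carrier N" "n' \<in> carrier N" for h n n'
    using auto[OF that(1)] that by (auto simp: auto_def hom_def)
  have act: "\<phi> (h \<otimes>\<^bsub>H\<^esub> h') n = \<phi> h (\<phi> h' n)"
    if "h \<in> carrier H" "h' \<in> carrier H" "n \<in> carrier N" for h h' n
    using that auto by (simp add: mult_AutoGroup compose_def)
  have one: "\<phi> \<one>\<^bsub>H\<^esub> n = n" if "n \<in> carrier N" for n
    using that by (simp add: one_AutoGroup)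
  show ?thesis
  proof (rule groupI)
    fix x assume "x \<in> carrier (semidirect N H \<phi>)"
    then obtain n h where x: "x = (n, h)" "n \<in> carrier N" "h \<in> carrier H"
      by (auto simp: semidirect_def)
    have "(\<phi> (inv\<^bsub>H\<^esub> h) (inv\<^bsub>N\<^esub> n), inv\<^bsub>H\<^esub> h) \<otimes>\<^bsub>semidirect N H \<phi>\<^esub> x = \<one>\<^bsub>semidirect N H \<phi>\<^esub>"
      using x hom[of "inv\<^bsub>H\<^esub> h" "inv\<^bsub>N\<^esub> n" n] hom[of "inv\<^bsub>H\<^esub> h" "\<one>\<^bsub>N\<^esub>" "\<one>\<^bsub>N\<^esub>"]
        cl[of "inv\<^bsub>H\<^esub> h" "\<one>\<^bsub>N\<^esub>"] by (simp add: semidirect_def)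
    then show "\<exists>y\<in>carrier (semidirect N H \<phi>). y \<otimes>\<^bsub>semidirect N H \<phi>\<^esub> x = \<one>\<^bsub>semidirect N H \<phi>\<^esub>"
      by (rule rev_bexI[rotated]) (use x in \<open>auto simp: semidirect_def cl simp del: \<phi>.hom_inv\<close>)
  qed (auto simp: semidirect_def cl hom act one N.m_assoc H.m_assoc simp del: \<phi>.hom_mult \<phi>.hom_one)
qed


section \<open>Dyer graphs and Dyer groups\<close>

definition simplicial_graph :: "'a set \<Rightarrow> 'a set set \<Rightarrow> bool"
  where "simplicial_graph V E \<longleftrightarrow> (\<forall>e\<in>E. e \<subseteq> V \<and> card e = 2)"

locale dyer_graph =
  fixes V :: "'a set" and E :: "'a set set" and f :: "'a \<Rightarrow> enat" and m :: "'a set \<Rightarrow> nat"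
  assumes graph: "simplicial_graph V E"
    and f_ge2: "v \<in> V \<Longrightarrow> 2 \<le> f v"
    and m_ge2: "e \<in> E \<Longrightarrow> 2 \<le> m e"
    and m_eq2: "{v, w} \<in> E \<Longrightarrow> 3 \<le> f v \<Longrightarrow> m {v, w} = 2"

definition V_two :: "'a set \<Rightarrow> ('a \<Rightarrow> enat) \<Rightarrow> 'a set"
  where "V_two V f = {v \<in> V. f v = 2}"

definition V_inf :: "'a set \<Rightarrow> ('a \<Rightarrow> enat) \<Rightarrow> 'a set"
  where "V_inf V f = {v \<in> V. f v = \<infinity>}"

definition V_p :: "'a set \<Rightarrow> ('a \<Rightarrow> enat) \<Rightarrow> 'a set"
  where "V_p V f = V - (V_two V f \<union> V_inf V f)"

fun alternating :: "'a \<Rightarrow> 'a \<Rightarrow> nat \<Rightarrow> 'a list" where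
  "alternating a b 0 = []"
| "alternating a b (Suc k) = a # alternating b a k"

definition dyer_rels :: "'a set \<Rightarrow> 'a set set \<Rightarrow> ('a \<Rightarrow> enat) \<Rightarrow> ('a set \<Rightarrow> nat) \<Rightarrow> ('a gword \<times> 'a gword) set"
  where "dyer_rels V E f m =
    {(replicate (the_enat (f v)) (v, True), []) | v. v \<in> V \<and> f v \<noteq> \<infinity>} \<union>
    {(alternating (v, True) (u, True) (m {u, v}), alternating (u, True) (v, True) (m {u, v})) | u v.
       {u, v} \<in> E}"

definition dyer_group :: "'a set \<Rightarrow> 'a set set \<Rightarrow> ('a \<Rightarrow> enat) \<Rightarrow> ('a set \<Rightarrow> nat) \<Rightarrow> 'a gword set monoid"
  where "dyer_group V E f m = presented_group V (dyer_rels V E f m)"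

definition dyer_gen :: "'a set \<Rightarrow> 'a set set \<Rightarrow> ('a \<Rightarrow> enat) \<Rightarrow> ('a set \<Rightarrow> nat) \<Rightarrow> 'a \<Rightarrow> 'a gword set"
  where "dyer_gen V E f m v = pres_gen V (dyer_rels V E f m) v"


section \<open>Coxeter groups and the graph \<open>\<Lambda>\<close>\<close>

definition coxeter_rels :: "'a set \<Rightarrow> 'a set set \<Rightarrow> ('a set \<Rightarrow> nat) \<Rightarrow> ('a gword \<times> 'a gword) set"
  where "coxeter_rels V E m =
    {([(v, True), (v, True)], []) | v. v \<in> V} \<union>
    {(concat (replicate (m {u, v}) [(u, True), (v, True)]), []) | u v. {u, v} \<in> E}"

definition coxeter_group :: "'a set \<Rightarrow> 'a set set \<Rightarrow> ('a set \<Rightarrow> nat) \<Rightarrow> 'a gword set monoid"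
  where "coxeter_group V E m = presented_group V (coxeter_rels V E m)"

text \<open>\<open>Inl v\<close> is the vertex \<open>v \<in> V\<close> of \<open>\<Lambda>\<close>, and \<open>Inr v\<close> is the vertex \<open>v'\<close>.\<close>

definition Lambda_verts :: "'a set \<Rightarrow> ('a \<Rightarrow> enat) \<Rightarrow> ('a + 'a) set"
  where "Lambda_verts V f = Inl ` V \<union> Inr ` (V_p V f \<union> V_inf V f)"

definition Lambda_edges :: "'a set \<Rightarrow> 'a set set \<Rightarrow> ('a \<Rightarrow> enat) \<Rightarrow> ('a + 'a) set set"
  where "Lambda_edges V E f =
    {{Inl u, Inl v} | u v. {u, v} \<in> E} \<union>
    {{Inr u, x} | u x. u \<in> V_p V f \<union> V_inf V f \<and> x \<in> Lambda_verts V f - {Inl u, Inr u}} \<union>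
    {{Inl u, Inr u} | u. u \<in> V_p V f}"

definition Lambda_label :: "('a \<Rightarrow> enat) \<Rightarrow> ('a set \<Rightarrow> nat) \<Rightarrow> ('a + 'a) set \<Rightarrow> nat"
  where "Lambda_label f m e =
    (if e \<subseteq> range Inl then m (Inl -` e)
     else if \<exists>u. e = {Inl u, Inr u} then the_enat (f (THE u. e = {Inl u, Inr u}))
     else 2)"

lemma Lambda_label_simps:
  fixes f :: "'a \<Rightarrow> enat"
  shows
  "Lambda_label f m {Inl u, Inl v} = m {u, v}"
  "Lambda_label f m {Inl u, Inr u} = the_enat (f u)"
  "x \<noteq> Inl u \<Longrightarrow> Lambda_label f m {Inr u, x} = 2"
proof -
  have "(Inl :: 'a \<Rightarrow> 'a + 'a) -` {Inl u, Inl v} = {u, v}" by auto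
  then show "Lambda_label f m {Inl u, Inl v} = m {u, v}" by (simp add: Lambda_label_def)
  have "(THE u'. {Inl u, Inr u} = {Inl u', Inr u'}) = u" by (auto simp: doubleton_eq_iff)
  then show "Lambda_label f m {Inl u, Inr u} = the_enat (f u)" by (auto simp: Lambda_label_def)
  show "Lambda_label f m {Inr u, x} = 2" if "x \<noteq> Inl u"
    using that by (auto simp: Lambda_label_def doubleton_eq_iff)
qed


section \<open>The action \<open>\<xi>\<close>\<close>

definition dyer_inversion ::
    "'a set \<Rightarrow> 'a set set \<Rightarrow> ('a \<Rightarrow> enat) \<Rightarrow> ('a set \<Rightarrow> nat) \<Rightarrow> 'a \<Rightarrow> 'a gword set \<Rightarrow> 'a gword set"
  where "dyer_inversion V E f m v =
    (THE h. h \<in> hom (dyer_group V E f m) (dyer_group V E f m) \<and>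
       h \<in> extensional (carrier (dyer_group V E f m)) \<and>
       (\<forall>u\<in>V. h (dyer_gen V E f m u) =
         (if u = v then inv\<^bsub>dyer_group V E f m\<^esub> (dyer_gen V E f m u) else dyer_gen V E f m u)))"

text \<open>The factors of \<open>(\<int>/2\<int>)\<^sup>k\<close> are indexed by the \<open>k\<close> elements of \<open>V_p \<union> V_\<infinity>\<close> themselves.\<close>

definition Z2_power :: "'a set \<Rightarrow> ('a \<Rightarrow> int) monoid"
  where "Z2_power I = product_group I (\<lambda>_. integer_mod_group 2)"

text \<open>\<open>AutoGroup\<close> is not commutative, so this use of \<^const>\<open>finprod\<close> is meaningful only because
  the \<open>\<xi>_v\<close> commute with each other; see \<open>dyer_action_apply_gen\<close> and \<open>dyer_action_hom\<close> below.\<close>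

definition dyer_action ::
    "'a set \<Rightarrow> 'a set set \<Rightarrow> ('a \<Rightarrow> enat) \<Rightarrow> ('a set \<Rightarrow> nat) \<Rightarrow>
     ('a \<Rightarrow> int) \<Rightarrow> 'a gword set \<Rightarrow> 'a gword set"
  where "dyer_action V E f m g =
    (\<Otimes>\<^bsub>AutoGroup (dyer_group V E f m)\<^esub> v \<in> V_p V f \<union> V_inf V f.
       dyer_inversion V E f m v [^]\<^bsub>AutoGroup (dyer_group V E f m)\<^esub> g v)"

lemma (in group) word_eval_replicate:
  "\<phi> s \<in> carrier G \<Longrightarrow> word_eval G \<phi> (replicate n (s, True)) = \<phi> s [^] n"
  by (induction n) (simp_all add: word_eval_def nat_pow_Suc2[symmetric] del: nat_pow_Suc)

lemma (in group) commute_inv: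
  assumes "x \<in> carrier G" "y \<in> carrier G" "x \<otimes> y = y \<otimes> x"
  shows "inv x \<otimes> y = y \<otimes> inv x"
proof -
  have "inv x \<otimes> y \<otimes> x = y"
    using assms by (simp add: m_assoc flip: assms(3)) (simp add: m_assoc[symmetric])
  then show ?thesis using assms by (metis inv_closed inv_solve_right m_closed)
qed

lemma word_eval_cong:
  "(\<And>s b. (s, b) \<in> set w \<Longrightarrow> \<phi> s = \<psi> s) \<Longrightarrow> word_eval H \<phi> w = word_eval H \<psi> w"
  by (induction w) (fastforce simp: word_eval_def)+

lemma set_alternating: "set (alternating a b n) \<subseteq> {a, b}"
  by (induction a b n rule: alternating.induct) auto

context dyer_graph
begin

abbreviation "D \<equiv> dyer_group V E f m"
abbreviation "gen \<equiv> dyer_gen V E f m"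
abbreviation "I \<equiv> V_p V f \<union> V_inf V f"

lemma group_D: "group D" by (simp add: dyer_group_def group_presented)

sublocale D: group D by (rule group_D)

lemma gen_closed [simp]: "v \<in> V \<Longrightarrow> gen v \<in> carrier D"
  by (simp add: dyer_group_def dyer_gen_def pres_gen_closed)

lemma I_ge3: "v \<in> I \<Longrightarrow> v \<in> V \<and> 3 \<le> f v"
proof -
  assume v: "v \<in> I"
  then have "v \<in> V" "f v \<noteq> 2" by (auto simp: V_p_def V_inf_def V_two_def)
  with f_ge2[of v] show ?thesis
    by (cases "f v") (auto simp: numeral_eq_enat)
qed

lemma edge_verts: "{u, v} \<in> E \<Longrightarrow> u \<in> V \<and> v \<in> V"
  using graph by (auto simp: simplicial_graph_def)

lemma rels_words:
  assumes "(r, r') \<in> dyer_rels V E f m"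
  shows "r \<in> gwords V" "r' \<in> gwords V"
proof -
  have "alternating (u, True) (v, True) n \<in> gwords V" if "u \<in> V" "v \<in> V" for u v n
    using set_alternating[of "(u, True)" "(v, True)" n] that by (auto simp: gwords_def lists_eq_set)
  moreover have "replicate n (v, True) \<in> gwords V" if "v \<in> V" for v n
    using that by (induction n) auto
  ultimately show "r \<in> gwords V" "r' \<in> gwords V"
    using assms edge_verts by (auto simp: dyer_rels_def)
qed

lemma rels_hold:
  assumes "(r, r') \<in> dyer_rels V E f m"
  shows "word_eval D gen r = word_eval D gen r'"
proof -
  have id: "(\<lambda>x\<in>carrier D. x) \<in> hom D D"
    by (auto simp: hom_def)
  have ev: "pres_class V (dyer_rels V E f m) w = word_eval D gen w" if w: "w \<in> gwords V" for w
  proof -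
    have "pres_class V (dyer_rels V E f m) w
        = word_eval D (\<lambda>s. (\<lambda>x\<in>carrier D. x) (pres_gen V (dyer_rels V E f m) s)) w"
      using pres_class_hom_eq[OF D.is_group, of "\<lambda>x\<in>carrier D. x" V "dyer_rels V E f m" w] id w
      by (simp add: dyer_group_def carrier_presented)
    also have "\<dots> = word_eval D gen w"
      by (rule word_eval_cong)
        (use w in \<open>auto simp: gwords_def lists_eq_set dyer_group_def dyer_gen_def pres_gen_closed\<close>)
    finally show ?thesis .
  qed
  have "pres_eq V (dyer_rels V E f m) ([] @ r @ []) ([] @ r' @ [])"
    using assms rels_words[OF assms] by (intro pres_eq.rel) auto
  then have "pres_class V (dyer_rels V E f m) r = pres_class V (dyer_rels V E f m) r'"
    using rels_words(1)[OF assms] by (subst pres_class_eq_iff) simp_all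
  then show ?thesis by (simp only: ev[OF rels_words(1)[OF assms]] ev[OF rels_words(2)[OF assms]])
qed

definition flipped :: "'a set \<Rightarrow> 'a \<Rightarrow> 'a gword set"
  where "flipped J u = (if u \<in> J then inv\<^bsub>D\<^esub> (gen u) else gen u)"

lemma flipped_closed: "u \<in> V \<Longrightarrow> flipped J u \<in> carrier D"
  by (simp add: flipped_def)

lemma flipped_rels:
  assumes J: "J \<subseteq> I" and r: "(r, r') \<in> dyer_rels V E f m"
  shows "word_eval D (flipped J) r = word_eval D (flipped J) r'"
proof -
  consider (pow) v where "r = replicate (the_enat (f v)) (v, True)" "r' = []" "v \<in> V" "f v \<noteq> \<infinity>"
    | (edge) u v where "r = alternating (v, True) (u, True) (m {u, v})"
        "r' = alternating (u, True) (v, True) (m {u, v})" "{u, v} \<in> E"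
    using r unfolding dyer_rels_def by blast
  then show ?thesis
  proof cases
    case pow
    have "gen v [^]\<^bsub>D\<^esub> the_enat (f v) = \<one>\<^bsub>D\<^esub>"
      using rels_hold[OF r] pow by (simp add: D.word_eval_replicate) (simp add: word_eval_def)
    then have "flipped J v [^]\<^bsub>D\<^esub> the_enat (f v) = \<one>\<^bsub>D\<^esub>"
      using pow by (simp add: flipped_def D.nat_pow_inv)
    then show ?thesis using pow
      by (simp add: D.word_eval_replicate flipped_closed) (simp add: word_eval_def)
  next
    case edge
    have uv: "u \<in> V" "v \<in> V" using edge_verts edge by auto
    show ?thesis
    proof (cases "u \<in> J \<or> v \<in> J")
      case True
      then have m2: "m {u, v} = 2"
        using m_eq2[of u v] m_eq2[of v u] I_ge3 J edge(3) by (auto simp: insert_commute)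
      have "gen v \<otimes>\<^bsub>D\<^esub> gen u = gen u \<otimes>\<^bsub>D\<^esub> gen v"
        using rels_hold[OF r] uv by (simp add: edge m2 numeral_2_eq_2 word_eval_def)
      then have "flipped J v \<otimes>\<^bsub>D\<^esub> flipped J u = flipped J u \<otimes>\<^bsub>D\<^esub> flipped J v"
        using uv D.commute_inv[of "gen v" "gen u"] D.commute_inv[of "gen u" "gen v"]
          D.commute_inv[of "gen v" "inv\<^bsub>D\<^esub> (gen u)"]
        by (auto simp: flipped_def)
      then show ?thesis using uv flipped_closed by (simp add: edge m2 numeral_2_eq_2 word_eval_def)
    next
      case False
      have "word_eval D (flipped J) w = word_eval D gen w" if "set w \<subseteq> {(u, True), (v, True)}" for w
        by (rule word_eval_cong) (use that False in \<open>auto simp: flipped_def\<close>)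
      then show ?thesis
        using rels_hold[OF r] set_alternating[of "(u, True)" "(v, True)"]
          set_alternating[of "(v, True)" "(u, True)"]
        by (simp add: edge insert_commute)
    qed
  qed
qed

definition flip :: "'a set \<Rightarrow> 'a gword set \<Rightarrow> 'a gword set"
  where "flip J = (THE h. h \<in> hom D D \<and> h \<in> extensional (carrier D) \<and>
    (\<forall>u\<in>V. h (gen u) = flipped J u))"

lemma flip:
  assumes "J \<subseteq> I"
  shows flip_hom: "flip J \<in> hom D D" and flip_ext: "flip J \<in> extensional (carrier D)"
    and flip_gen: "u \<in> V \<Longrightarrow> flip J (gen u) = flipped J u"
proof -
  have "\<exists>!h. h \<in> hom D D \<and> h \<in> extensional (carrier D) \<and> (\<forall>u\<in>V. h (gen u) = flipped J u)"
    using presented_group_universal[OF D.is_group, of "flipped J" V "dyer_rels V E f m"]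
      flipped_rels[OF assms] flipped_closed
    by (auto simp: dyer_group_def dyer_gen_def)
  from theI'[OF this] show "flip J \<in> hom D D" "flip J \<in> extensional (carrier D)"
    "u \<in> V \<Longrightarrow> flip J (gen u) = flipped J u" by (auto simp: flip_def)
qed

lemma flip_unique:
  assumes "J \<subseteq> I" "h \<in> hom D D" "h \<in> extensional (carrier D)"
    "\<And>u. u \<in> V \<Longrightarrow> h (gen u) = flipped J u"
  shows "h = flip J"
  using presented_group_hom_unique[OF D.is_group, of h V "dyer_rels V E f m" "flip J"] assms flip[OF assms(1)]
  by (auto simp: dyer_group_def dyer_gen_def)

lemma flip_empty: "flip {} = (\<lambda>x\<in>carrier D. x)"
  by (rule flip_unique[symmetric]) (auto simp: flipped_def hom_def)

lemma flip_compose: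
  assumes "J \<subseteq> I" "K \<subseteq> I"
  shows "compose (carrier D) (flip J) (flip K) = flip ((J - K) \<union> (K - J))"
proof (rule flip_unique)
  interpret J: group_hom D D "flip J" by unfold_locales (rule flip_hom[OF assms(1)])
  show "compose (carrier D) (flip J) (flip K) \<in> hom D D"
    using D.hom_compose flip_hom assms by blast
  show "compose (carrier D) (flip J) (flip K) (gen u) = flipped (J - K \<union> (K - J)) u" if "u \<in> V" for u
    using that flip_gen[OF assms(1)] flip_gen[OF assms(2)] by (auto simp: compose_def flipped_def)
qed (use assms in auto)

lemma flip_auto: "J \<subseteq> I \<Longrightarrow> flip J \<in> auto D"
proof -
  assume J: "J \<subseteq> I"
  have inv: "flip J (flip J x) = x" if "x \<in> carrier D" for x
    using fun_cong[OF flip_compose[OF J J], of x] that by (simp add: compose_def flip_empty)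
  have cl: "flip J x \<in> carrier D" if "x \<in> carrier D" for x
    using flip_hom[OF J] that by (auto simp: hom_def)
  have "bij_betw (flip J) (carrier D) (carrier D)"
    by (rule bij_betw_byWitness[where f' = "flip J"]) (use inv cl in auto)
  then show ?thesis using flip[OF J] by (simp add: auto_def Bij_def)
qed

lemma flip_mult:
  assumes "J \<subseteq> I" "K \<subseteq> I"
  shows "flip J \<otimes>\<^bsub>AutoGroup D\<^esub> flip K = flip ((J - K) \<union> (K - J))"
  using flip_compose[OF assms] flip_auto assms by (simp add: mult_AutoGroup)

lemma dyer_inversion_eq: "dyer_inversion V E f m v = flip {v}"
  by (simp add: dyer_inversion_def flip_def flipped_def)

lemma dyer_inversion_auto: "v \<in> I \<Longrightarrow> dyer_inversion V E f m v \<in> auto D"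
  using flip_auto[of "{v}"] by (simp add: dyer_inversion_eq)

lemma dyer_inversion_gen:
  assumes "v \<in> I" "u \<in> V"
  shows "dyer_inversion V E f m v (gen u) = (if u = v then inv\<^bsub>D\<^esub> (gen u) else gen u)"
  using assms flip_gen[of "{v}" u] by (auto simp: dyer_inversion_eq flipped_def)

lemma Z2_power_carrier: "g \<in> carrier (Z2_power J) \<longleftrightarrow> g \<in> (\<Pi>\<^sub>E i\<in>J. {0, 1})"
proof -
  have "{0..<2::int} = {0, 1}" by auto
  then show ?thesis by (simp add: Z2_power_def carrier_integer_mod_group)
qed

lemma dyer_action_eq_flip:
  assumes "finite V" and g: "g \<in> carrier (Z2_power I)"
  shows "dyer_action V E f m g = flip {v \<in> I. g v = 1}"
proof -
  interpret A: group "AutoGroup D" by (rule D.AutoGroup)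
  let ?p = "\<lambda>v. dyer_inversion V E f m v [^]\<^bsub>AutoGroup D\<^esub> g v"
  have p: "?p v = flip ({v} \<inter> {v. g v = 1})" if "v \<in> I" for v
  proof -
    have "g v = 0 \<or> g v = 1" using g that unfolding Z2_power_carrier by (metis PiE_mem empty_iff insert_iff)
    then show ?thesis
      using that dyer_inversion_auto[OF that] A.int_pow_1[of "dyer_inversion V E f m v"]
      by (auto simp: dyer_inversion_eq flip_empty one_AutoGroup carrier_AutoGroup)
  qed
  have pa: "?p v \<in> carrier (AutoGroup D)" if "v \<in> I" for v
    unfolding p[OF that] carrier_AutoGroup by (rule flip_auto) (use that in auto)
  have comm: "?p v \<otimes>\<^bsub>AutoGroup D\<^esub> ?p w = ?p w \<otimes>\<^bsub>AutoGroup D\<^esub> ?p v" if "v \<in> I" "w \<in> I" for v w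
    unfolding p[OF that(1)] p[OF that(2)] using that by (subst (1 2) flip_mult) (auto simp: Un_commute)
  interpret L: LCD I "carrier (AutoGroup D)" "monoid.mult (AutoGroup D) \<circ> ?p"
  proof
    fix x y z assume xyz: "x \<in> I" "y \<in> I" "z \<in> carrier (AutoGroup D)"
    show "((\<otimes>\<^bsub>AutoGroup D\<^esub>) \<circ> ?p) x (((\<otimes>\<^bsub>AutoGroup D\<^esub>) \<circ> ?p) y z) =
        ((\<otimes>\<^bsub>AutoGroup D\<^esub>) \<circ> ?p) y (((\<otimes>\<^bsub>AutoGroup D\<^esub>) \<circ> ?p) x z)"
      using pa[OF xyz(1)] pa[OF xyz(2)] comm[OF xyz(1,2)] xyz(3) by (simp add: A.m_assoc[symmetric])
  qed (use pa in auto)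
  have fin: "finite I" using assms(1) I_ge3 by (meson finite_subset subsetI)
  have "foldD (carrier (AutoGroup D)) (monoid.mult (AutoGroup D) \<circ> ?p) \<one>\<^bsub>AutoGroup D\<^esub> A = flip {v \<in> A. g v = 1}"
    if "finite A" "A \<subseteq> I" for A
    using that
  proof (induction A)
    case empty
    have "flip {v \<in> {}. g v = 1} = \<one>\<^bsub>AutoGroup D\<^esub>"
      by (simp add: flip_empty one_AutoGroup)
    then show ?case by (simp only: foldD_empty[OF A.one_closed])
  next
    case (insert x A)
    have "foldD (carrier (AutoGroup D)) (monoid.mult (AutoGroup D) \<circ> ?p) \<one>\<^bsub>AutoGroup D\<^esub> (insert x A)
        = ?p x \<otimes>\<^bsub>AutoGroup D\<^esub> flip {v \<in> A. g v = 1}"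
    proof -
      have A: "A \<subseteq> I" "x \<in> I" using insert.prems by auto
      show ?thesis
        unfolding L.foldD_insert[OF insert.hyps A(2) A.one_closed A(1)] insert.IH[OF A(1)] by simp
    qed
    also have "\<dots> = flip ({x} \<inter> {v. g v = 1} - {v \<in> A. g v = 1} \<union> ({v \<in> A. g v = 1} - {x} \<inter> {v. g v = 1}))"
    proof -
      have "{x} \<inter> {v. g v = 1} \<subseteq> I" "{v \<in> A. g v = 1} \<subseteq> I" "x \<in> I" using insert by auto
      then show ?thesis using p[of x] flip_mult by simp
    qed
    also have "{x} \<inter> {v. g v = 1} - {v \<in> A. g v = 1} \<union> ({v \<in> A. g v = 1} - {x} \<inter> {v. g v = 1})
        = {v \<in> insert x A. g v = 1}"
      using insert by auto
    finally show ?case .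
  qed
  from this[OF fin] fin show ?thesis by (simp add: dyer_action_def finprod_def)
qed

lemma dyer_action_apply_gen:
  assumes "finite V" "g \<in> carrier (Z2_power I)" "u \<in> V"
  shows "dyer_action V E f m g (gen u) = (if u \<in> I \<and> g u = 1 then inv\<^bsub>D\<^esub> (gen u) else gen u)"
  unfolding dyer_action_eq_flip[OF assms(1,2)]
  by (subst flip_gen) (use assms(3) in \<open>auto simp: flipped_def\<close>)

lemma dyer_action_gen:
  assumes "finite V" "v \<in> I"
  shows "dyer_action V E f m (\<lambda>u\<in>I. if u = v then 1 else 0) = dyer_inversion V E f m v"
proof -
  have "{u \<in> I. (\<lambda>u\<in>I. if u = v then 1 else 0 :: int) u = 1} = {v}" using assms by auto
  moreover have "(\<lambda>u\<in>I. if u = v then 1 else 0) \<in> carrier (Z2_power I)"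
    unfolding Z2_power_carrier by auto
  ultimately show ?thesis
    unfolding dyer_inversion_eq by (simp only: dyer_action_eq_flip[OF assms(1)])
qed

lemma dyer_action_hom:
  assumes "finite V"
  shows "dyer_action V E f m \<in> hom (Z2_power I) (AutoGroup D)"
proof (rule homI)
  fix g h assume g: "g \<in> carrier (Z2_power I)" and h: "h \<in> carrier (Z2_power I)"
  have "group (Z2_power I)" by (simp add: Z2_power_def)
  then have gh: "g \<otimes>\<^bsub>Z2_power I\<^esub> h \<in> carrier (Z2_power I)"
    using g h by (simp add: group.is_monoid monoid.m_closed)
  have "g v \<in> {0, 1}" "h v \<in> {0, 1}" if "v \<in> I" for v
    using g h that unfolding Z2_power_carrier by (auto simp only: PiE_mem)
  then have "{v \<in> I. (g \<otimes>\<^bsub>Z2_power I\<^esub> h) v = 1}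
      = {v \<in> I. g v = 1} - {v \<in> I. h v = 1} \<union> ({v \<in> I. h v = 1} - {v \<in> I. g v = 1})"
    by (fastforce simp: Z2_power_def)
  then show "dyer_action V E f m (g \<otimes>\<^bsub>Z2_power I\<^esub> h)
      = dyer_action V E f m g \<otimes>\<^bsub>AutoGroup D\<^esub> dyer_action V E f m h"
    unfolding dyer_action_eq_flip[OF assms gh] dyer_action_eq_flip[OF assms g] dyer_action_eq_flip[OF assms h]
    by (subst flip_mult) auto
next
  fix g assume "g \<in> carrier (Z2_power I)"
  then show "dyer_action V E f m g \<in> carrier (AutoGroup D)"
    by (simp only: dyer_action_eq_flip[OF assms] carrier_AutoGroup) (rule flip_auto, auto)
qed

end

end

theory Submission
  imports Defs
begin

text \<open>
  The isomorphism sends \<open>y_v\<close> to \<open>(x_v, e_v)\<close> and \<open>y_{v'}\<close> to \<open>(1, e_v)\<close>, where \<open>e_v\<close> is the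
  generator of \<open>(\<int>/2\<int>)\<^sup>k\<close> indexed by \<open>v\<close>, and \<open>e_v = 1\<close> if \<open>f v = 2\<close>. Its inverse sends \<open>e_v\<close> to
  \<open>y_{v'}\<close> and \<open>x_v\<close> to \<open>y_v\<close> if \<open>f v = 2\<close>, to the product \<open>y_v y_{v'}\<close> otherwise. Conjugation by
  \<open>y_{v'}\<close> inverts \<open>y_v y_{v'}\<close> and fixes the images of the other \<open>x_u\<close>, so it induces \<open>\<xi>_v\<close>.
  Both maps are homomorphisms by the universal properties of the two sides, and
  they are mutually inverse because they are so on generators.
\<close>

section \<open>Presented groups and alternating words\<close>

text \<open>Stated pointwise on the carrier because the composites compared below, such as
  \<open>\<lambda>x. k (h x)\<close>, are not cut off outside it. Every element is the class of a
  word, and its image is determined by the images of the letters.\<close>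

lemma pres_class_hom_cong:
  assumes "group H" "h \<in> hom (presented_group S R) H" "h' \<in> hom (presented_group S R) H"
    and "\<And>s. s \<in> S \<Longrightarrow> h (pres_gen S R s) = h' (pres_gen S R s)"
    and "x \<in> carrier (presented_group S R)"
  shows "h x = h' x"
proof -
  obtain w where w: "w \<in> gwords S" "x = pres_class S R w"
    using assms(5) by (auto simp: carrier_presented)
  have "word_eval H (\<lambda>s. h (pres_gen S R s)) w = word_eval H (\<lambda>s. h' (pres_gen S R s)) w"
    by (rule word_eval_cong) (use w(1) assms(4) in \<open>auto simp: gwords_def lists_eq_set\<close>)
  then show ?thesis
    using pres_class_hom_eq[OF assms(1,2) w(1)] pres_class_hom_eq[OF assms(1,3) w(1)] w(2) by simp
qed

text \<open>Evaluating a word at the generators gives its own class, by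
  \<open>pres_class_hom_eq\<close> for the identity homomorphism, and the two sides of a relation
  have the same class.\<close>

lemma presented_group_rel:
  assumes "(r, r') \<in> R" "r \<in> gwords S" "r' \<in> gwords S"
  shows "word_eval (presented_group S R) (pres_gen S R) r
    = word_eval (presented_group S R) (pres_gen S R) r'"
proof -
  have "(\<lambda>x. x) \<in> hom (presented_group S R) (presented_group S R)"
    by (simp add: hom_def)
  from pres_class_hom_eq[OF group_presented this] have ev:
    "word_eval (presented_group S R) (pres_gen S R) w = pres_class S R w" if "w \<in> gwords S" for w
    using that by simp
  have "pres_eq S R ([] @ r @ []) ([] @ r' @ [])"
    using assms by (intro pres_eq.rel) auto
  then show ?thesis using assms by (simp add: ev pres_class_eq_iff)
qed

lemma word_eval_Nil [simp]: "word_eval H \<phi> [] = \<one>\<^bsub>H\<^esub>"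
  by (simp add: word_eval_def)

lemma word_eval_Cons [simp]:
  "word_eval H \<phi> ((s, b) # w) = (if b then \<phi> s else inv\<^bsub>H\<^esub> (\<phi> s)) \<otimes>\<^bsub>H\<^esub> word_eval H \<phi> w"
  by (simp add: word_eval_def)

lemma (in group) word_eval_concat_replicate:
  assumes "\<phi> s \<in> carrier G" "\<phi> t \<in> carrier G"
  shows "word_eval G \<phi> (concat (replicate n [(s, True), (t, True)])) = (\<phi> s \<otimes> \<phi> t) [^] n"
proof (induction n)
  case (Suc n)
  have "(\<phi> s \<otimes> \<phi> t) [^] Suc n = (\<phi> s \<otimes> \<phi> t) \<otimes> (\<phi> s \<otimes> \<phi> t) [^] n"
    using assms by (intro nat_pow_Suc2) simp
  then show ?case using Suc assms by (simp add: m_assoc del: nat_pow_Suc)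
qed simp

section \<open>Alternating products of two involutions\<close>

lemma (in group) word_eval_alternating_closed:
  assumes "\<phi> s \<in> carrier G" "\<phi> t \<in> carrier G"
  shows "word_eval G \<phi> (alternating (s, True) (t, True) n) \<in> carrier G"
  using assms by (induction n arbitrary: s t) simp_all

text \<open>Both sides are the product \<open>x y x ... x\<close> with \<open>n\<close> letters
  \<open>y\<close>. Cancelling \<open>x\<close> turns \<open>(x y)^n = 1\<close> into
  \<open>(y x)^n = 1\<close>, which frees Coxeter relations from the order of the endpoints.\<close>

lemma (in group) pow_swap:
  assumes "x \<in> carrier G" "y \<in> carrier G"
  shows "x \<otimes> (y \<otimes> x) [^] (n::nat) = (x \<otimes> y) [^] n \<otimes> x"
proof (induction n)
  case (Suc n)
  have "x \<otimes> (y \<otimes> x) [^] Suc n = (x \<otimes> (y \<otimes> x) [^] n) \<otimes> (y \<otimes> x)"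
    using assms by (simp add: m_assoc)
  also have "\<dots> = (x \<otimes> y) [^] Suc n \<otimes> x"
    unfolding Suc using assms by (simp add: m_assoc)
  finally show ?case .
qed (use assms in simp)

text \<open>For involutions the inverse of an alternating word is its reversal, so the quotient of
  the two words is \<open>(s t)^n\<close>. The induction exchanges \<open>s\<close> and
  \<open>t\<close> at each letter, hence both are arbitrary.\<close>

lemma (in group) word_eval_alternating_swap:
  assumes "\<phi> s \<in> carrier G" "\<phi> t \<in> carrier G" "\<phi> s \<otimes> \<phi> s = \<one>" "\<phi> t \<otimes> \<phi> t = \<one>"
  shows "word_eval G \<phi> (alternating (s, True) (t, True) n)
    = (\<phi> s \<otimes> \<phi> t) [^] n \<otimes> word_eval G \<phi> (alternating (t, True) (s, True) n)"
  using assms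
proof (induction n arbitrary: s t)
  case (Suc n)
  let ?A = "word_eval G \<phi> (alternating (s, True) (t, True) n)"
  have A: "?A \<in> carrier G" using Suc.prems by (simp add: word_eval_alternating_closed)
  have tt: "\<phi> t \<otimes> (\<phi> t \<otimes> z) = z" if "z \<in> carrier G" for z
    using Suc.prems that by (simp add: m_assoc[symmetric])
  have "word_eval G \<phi> (alternating (s, True) (t, True) (Suc n))
      = \<phi> s \<otimes> ((\<phi> t \<otimes> \<phi> s) [^] n \<otimes> ?A)"
    using Suc.IH[of t s] Suc.prems by simp
  also have "\<dots> = (\<phi> s \<otimes> \<phi> t) [^] n \<otimes> \<phi> s \<otimes> ?A"
    using Suc.prems A by (simp add: pow_swap flip: m_assoc)
  \<comment> \<open>Inserting the square of \<open>\<phi> t\<close> completes one more factor of the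
    power and supplies the first letter of the word starting with \<open>t\<close>.\<close>
  also have "\<dots> = (\<phi> s \<otimes> \<phi> t) [^] Suc n \<otimes> (\<phi> t \<otimes> ?A)"
    using Suc.prems A by (simp add: m_assoc tt)
  finally show ?case by simp
qed simp

text \<open>Translates between the braid relations of a Dyer group and the power relations of a
  Coxeter group when both generators are involutions.\<close>

lemma (in group) word_eval_alternating_eq_iff:
  assumes "\<phi> s \<in> carrier G" "\<phi> t \<in> carrier G" "\<phi> s \<otimes> \<phi> s = \<one>" "\<phi> t \<otimes> \<phi> t = \<one>"
  shows "word_eval G \<phi> (alternating (s, True) (t, True) n)
      = word_eval G \<phi> (alternating (t, True) (s, True) n) \<longleftrightarrow> (\<phi> s \<otimes> \<phi> t) [^] n = \<one>"
  using assms word_eval_alternating_closed[of \<phi> t s n]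
  by (simp add: word_eval_alternating_swap[of \<phi> s t])

text \<open>\<open>x \<otimes> y\<close> is its own inverse, while inverting a product of two
  involutions reverses it.\<close>

lemma (in group) commute_if_square_eq_one:
  assumes "x \<in> carrier G" "y \<in> carrier G" "x \<otimes> x = \<one>" "y \<otimes> y = \<one>" "(x \<otimes> y) [^] (2::nat) = \<one>"
  shows "x \<otimes> y = y \<otimes> x"
proof -
  have "x \<otimes> y = inv (x \<otimes> y)"
    using assms by (intro inv_equality[symmetric]) (simp_all add: numeral_2_eq_2)
  also have "\<dots> = y \<otimes> x"
    using assms by (simp add: inv_mult_group inv_equality)
  finally show ?thesis .
qed

section \<open>Homomorphisms out of elementary abelian 2-groups and semidirect products\<close>

lemma group_Z2_power: "group (Z2_power J)"
  by (simp add: Z2_power_def)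

lemma Z2_power_carrier_iff: "g \<in> carrier (Z2_power J) \<longleftrightarrow> g \<in> J \<rightarrow>\<^sub>E {0, 1}"
proof -
  have "{0..<2::int} = {0, 1}" by auto
  then show ?thesis by (simp add: Z2_power_def carrier_integer_mod_group)
qed

lemma Z2_power_mult:
  "g \<otimes>\<^bsub>Z2_power J\<^esub> h = (\<lambda>v\<in>J. (g v + h v) mod 2)"
  by (simp add: Z2_power_def)

lemma Z2_power_one: "\<one>\<^bsub>Z2_power J\<^esub> = (\<lambda>v\<in>J. 0)"
  by (simp add: Z2_power_def)

definition Z2_unit :: "'a set \<Rightarrow> 'a \<Rightarrow> 'a \<Rightarrow> int"
  where "Z2_unit J v = (\<lambda>u\<in>J. if u = v then 1 else 0)"

lemma Z2_unit_closed [simp]: "Z2_unit J v \<in> carrier (Z2_power J)"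
  by (auto simp: Z2_unit_def Z2_power_carrier_iff)

lemma Z2_unit_square: "Z2_unit J v \<otimes>\<^bsub>Z2_power J\<^esub> Z2_unit J v = \<one>\<^bsub>Z2_power J\<^esub>"
  by (auto simp: Z2_unit_def Z2_power_mult Z2_power_one restrict_def)

lemma Z2_power_commute: "g \<otimes>\<^bsub>Z2_power J\<^esub> h = h \<otimes>\<^bsub>Z2_power J\<^esub> g"
  by (simp add: Z2_power_mult add.commute)

text \<open>An element is the indicator function of the set where it equals 1, a finite subset of
  \<open>J\<close>; enlarging this set by a new point is multiplication by the unit of that
  point.\<close>

lemma Z2_power_induct [consumes 2, case_names one unit]:
  assumes "finite J" "g \<in> carrier (Z2_power J)"
    and one: "P \<one>\<^bsub>Z2_power J\<^esub>"
    and unit: "\<And>v g. v \<in> J \<Longrightarrow> g \<in> carrier (Z2_power J) \<Longrightarrow> P g \<Longrightarrow>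
      P (Z2_unit J v \<otimes>\<^bsub>Z2_power J\<^esub> g)"
  shows "P g"
proof -
  have "P (\<lambda>v\<in>J. of_bool (v \<in> K))" if "finite K" "K \<subseteq> J" for K
    using that
  proof (induction K)
    case empty
    then show ?case using one by (simp add: Z2_power_one restrict_def)
  next
    case (insert x K)
    have "(\<lambda>v\<in>J. of_bool (v \<in> insert x K)) = Z2_unit J x \<otimes>\<^bsub>Z2_power J\<^esub> (\<lambda>v\<in>J. of_bool (v \<in> K))"
      using insert.hyps by (auto simp: Z2_power_mult Z2_unit_def restrict_def fun_eq_iff)
    moreover have "P (Z2_unit J x \<otimes>\<^bsub>Z2_power J\<^esub> (\<lambda>v\<in>J. of_bool (v \<in> K)))"
    proof (rule unit)
      show "P (\<lambda>v\<in>J. of_bool (v \<in> K))" using insert.IH insert.prems by blast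
    qed (use insert.prems in \<open>auto simp: Z2_power_carrier_iff\<close>)
    ultimately show ?case by (simp only:)
  qed
  from this[of "{v \<in> J. g v = 1}"] assms(1)
  have "P (\<lambda>v\<in>J. of_bool (v \<in> {v \<in> J. g v = 1}))" by auto
  also have "(\<lambda>v\<in>J. of_bool (v \<in> {v \<in> J. g v = 1})) = g"
    using assms(2) by (fastforce simp: Z2_power_carrier_iff PiE_def extensional_def fun_eq_iff)
  finally show ?thesis .
qed

lemma Z2_power_hom_cong:
  assumes "finite J" "group H" "h \<in> hom (Z2_power J) H" "h' \<in> hom (Z2_power J) H"
    and "\<And>v. v \<in> J \<Longrightarrow> h (Z2_unit J v) = h' (Z2_unit J v)"
    and "g \<in> carrier (Z2_power J)"
  shows "h g = h' g"
  using assms(1,6)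
proof (induction rule: Z2_power_induct)
  case one
  show ?case using hom_one[OF assms(3) group_Z2_power assms(2)] hom_one[OF assms(4) group_Z2_power assms(2)]
    by simp
next
  case (unit v g)
  then show ?case using assms by (simp add: hom_mult)
qed

text \<open>The universal property: commuting involutions extend to a homomorphism. As
  \<open>G\<close> need not be abelian, the product of the chosen \<open>t v\<close> is built one
  coordinate at a time.\<close>

lemma (in group) Z2_power_hom_exists:
  assumes "finite J" "\<And>v. v \<in> J \<Longrightarrow> t v \<in> carrier G" "\<And>v. v \<in> J \<Longrightarrow> t v \<otimes> t v = \<one>"
    and "\<And>u v. u \<in> J \<Longrightarrow> v \<in> J \<Longrightarrow> t u \<otimes> t v = t v \<otimes> t u"
  shows "\<exists>\<tau>\<in>hom (Z2_power J) G. \<forall>v\<in>J. \<tau> (Z2_unit J v) = t v"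
  using assms
proof (induction J)
  case empty
  show ?case by (rule bexI[of _ "\<lambda>_. \<one>"]) (auto simp: hom_def)
next
  case (insert x J)
  then obtain \<tau> where \<tau>: "\<tau> \<in> hom (Z2_power J) G" and \<tau>_unit: "\<And>v. v \<in> J \<Longrightarrow> \<tau> (Z2_unit J v) = t v"
    by auto
  have tx: "t x \<in> carrier G" "t x \<otimes> t x = \<one>" using insert.prems by auto
  note cl = hom_in_carrier[OF \<tau>]
  note \<tau>_one = hom_one[OF \<tau> group_Z2_power is_group]
  \<comment> \<open>\<open>t x\<close> commutes with the images of the units, hence with the whole
    image of \<open>\<tau>\<close>; this lets the new factor be multiplied onto
    \<open>\<tau>\<close>.\<close>
  have comm: "t x \<otimes> \<tau> g = \<tau> g \<otimes> t x" if "g \<in> carrier (Z2_power J)" for g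
    using insert.hyps(1) that
  proof (induction rule: Z2_power_induct)
    case one
    then show ?case using \<tau>_one tx by simp
  next
    case (unit v g)
    have v: "t v \<in> carrier G" "t x \<otimes> t v = t v \<otimes> t x" using unit insert.prems by auto
    have "t x \<otimes> (t v \<otimes> \<tau> g) = t v \<otimes> (t x \<otimes> \<tau> g)"
      using v tx cl[OF unit(2)] by (simp flip: m_assoc)
    then show ?case using unit v tx cl[OF unit(2)] hom_mult[OF \<tau>, of "Z2_unit J v" g]
      by (simp add: \<tau>_unit m_assoc)
  qed
  define c where "c = (\<lambda>g::_ \<Rightarrow> int. if g x = 1 then t x else \<one>)"
  define \<sigma> where "\<sigma> = (\<lambda>g. c g \<otimes> \<tau> (restrict g J))"
  have c: "c g \<in> carrier G" for g using tx by (simp add: c_def)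
  have res: "restrict g J \<in> carrier (Z2_power J)" if "g \<in> carrier (Z2_power (insert x J))" for g
    using that by (auto simp: Z2_power_carrier_iff)
  have "\<sigma> \<in> hom (Z2_power (insert x J)) G"
  proof (rule homI)
    fix g h assume gh: "g \<in> carrier (Z2_power (insert x J))" "h \<in> carrier (Z2_power (insert x J))"
    note r = res[OF gh(1)] res[OF gh(2)]
    have "g x \<in> {0, 1}" "h x \<in> {0, 1}" using gh unfolding Z2_power_carrier_iff by blast+
    \<comment> \<open>When both coordinates are 1 their sum is 0 modulo 2, which matches
      \<open>t x \<otimes> t x = \<one>\<close>.\<close>
    then have 1: "c (g \<otimes>\<^bsub>Z2_power (insert x J)\<^esub> h) = c g \<otimes> c h"
      using tx by (auto simp: c_def Z2_power_mult)
    have "restrict (g \<otimes>\<^bsub>Z2_power (insert x J)\<^esub> h) J = restrict g J \<otimes>\<^bsub>Z2_power J\<^esub> restrict h J"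
      by (auto simp: Z2_power_mult)
    then have 2: "\<tau> (restrict (g \<otimes>\<^bsub>Z2_power (insert x J)\<^esub> h) J) = \<tau> (restrict g J) \<otimes> \<tau> (restrict h J)"
      using hom_mult[OF \<tau> r] by simp
    have 3: "\<tau> (restrict g J) \<otimes> c h = c h \<otimes> \<tau> (restrict g J)"
      using comm[OF r(1)] cl[OF r(1)] by (simp add: c_def)
    have "\<sigma> (g \<otimes>\<^bsub>Z2_power (insert x J)\<^esub> h) = c g \<otimes> (c h \<otimes> \<tau> (restrict g J)) \<otimes> \<tau> (restrict h J)"
      using cl r c by (simp add: \<sigma>_def 1 2 m_assoc)
    then show "\<sigma> (g \<otimes>\<^bsub>Z2_power (insert x J)\<^esub> h) = \<sigma> g \<otimes> \<sigma> h"
      using cl r c by (simp add: \<sigma>_def flip: 3) (simp add: m_assoc)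
  qed (use c cl res in \<open>simp add: \<sigma>_def\<close>)
  moreover have "\<sigma> (Z2_unit (insert x J) v) = t v" if v: "v \<in> insert x J" for v
  proof (cases "v = x")
    case True
    have "restrict (Z2_unit (insert x J) v) J = \<one>\<^bsub>Z2_power J\<^esub>"
      using insert.hyps True by (auto simp: Z2_unit_def Z2_power_one)
    then show ?thesis using True tx \<tau>_one by (simp add: \<sigma>_def c_def) (simp add: Z2_unit_def)
  next
    case False
    then have "restrict (Z2_unit (insert x J) v) J = Z2_unit J v" "v \<in> J"
      using v by (auto simp: Z2_unit_def)
    then show ?thesis using False \<tau>_unit[of v] insert.prems(1)[of v]
      by (simp add: \<sigma>_def c_def) (simp add: Z2_unit_def)
  qed
  ultimately show ?case by blast
qed

section \<open>Homomorphisms out of a semidirect product\<close>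

lemma semidirect_simps:
  "carrier (semidirect N H \<phi>) = carrier N \<times> carrier H"
  "(n, h) \<otimes>\<^bsub>semidirect N H \<phi>\<^esub> (n', h') = (n \<otimes>\<^bsub>N\<^esub> \<phi> h n', h \<otimes>\<^bsub>H\<^esub> h')"
  "\<one>\<^bsub>semidirect N H \<phi>\<^esub> = (\<one>\<^bsub>N\<^esub>, \<one>\<^bsub>H\<^esub>)"
  by (simp_all add: semidirect_def)

text \<open>In the product of two values, \<open>twist\<close> moves \<open>b h\<close> past
  \<open>a n'\<close> at the cost of applying \<open>\<phi> h\<close> to \<open>n'\<close>, exactly
  as in the semidirect multiplication.\<close>

lemma hom_semidirectI:
  assumes "group N" "group H" "group G" "\<phi> \<in> hom H (AutoGroup N)" "a \<in> hom N G" "b \<in> hom H G"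
    and twist: "\<And>n h. n \<in> carrier N \<Longrightarrow> h \<in> carrier H \<Longrightarrow>
      b h \<otimes>\<^bsub>G\<^esub> a n = a (\<phi> h n) \<otimes>\<^bsub>G\<^esub> b h"
  shows "(\<lambda>(n, h). a n \<otimes>\<^bsub>G\<^esub> b h) \<in> hom (semidirect N H \<phi>) G"
proof (rule homI)
  interpret G: group G by fact
  note a = hom_in_carrier[OF assms(5)] and b = hom_in_carrier[OF assms(6)]
  show "(\<lambda>(n, h). a n \<otimes>\<^bsub>G\<^esub> b h) x \<in> carrier G" if "x \<in> carrier (semidirect N H \<phi>)" for x
    using that a b by (auto simp: semidirect_simps)
  fix x y assume "x \<in> carrier (semidirect N H \<phi>)" "y \<in> carrier (semidirect N H \<phi>)"
  then obtain n h n' h' where xy: "x = (n, h)" "y = (n', h')"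
    and c: "n \<in> carrier N" "h \<in> carrier H" "n' \<in> carrier N" "h' \<in> carrier H"
    by (auto simp: semidirect_simps)
  have "\<phi> h \<in> auto N" using hom_in_carrier[OF assms(4) c(2)] by (simp add: carrier_AutoGroup)
  then have \<phi>: "\<phi> h n' \<in> carrier N" using c(3) by (auto simp: auto_def hom_def)
  have "a n \<otimes>\<^bsub>G\<^esub> b h \<otimes>\<^bsub>G\<^esub> (a n' \<otimes>\<^bsub>G\<^esub> b h') = a n \<otimes>\<^bsub>G\<^esub> (b h \<otimes>\<^bsub>G\<^esub> a n') \<otimes>\<^bsub>G\<^esub> b h'"
    using a b c by (simp add: G.m_assoc)
  also have "\<dots> = a n \<otimes>\<^bsub>G\<^esub> a (\<phi> h n') \<otimes>\<^bsub>G\<^esub> (b h \<otimes>\<^bsub>G\<^esub> b h')"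
    using a b c \<phi> by (simp add: twist G.m_assoc)
  finally show "(\<lambda>(n, h). a n \<otimes>\<^bsub>G\<^esub> b h) (x \<otimes>\<^bsub>semidirect N H \<phi>\<^esub> y)
      = (\<lambda>(n, h). a n \<otimes>\<^bsub>G\<^esub> b h) x \<otimes>\<^bsub>G\<^esub> (\<lambda>(n, h). a n \<otimes>\<^bsub>G\<^esub> b h) y"
    using c \<phi> by (simp add: xy semidirect_simps hom_mult[OF assms(5)] hom_mult[OF assms(6)])
qed

section \<open>Coxeter groups\<close>

lemma coxeter_gen_square:
  assumes "v \<in> S"
  shows "pres_gen S (coxeter_rels S F l) v \<otimes>\<^bsub>coxeter_group S F l\<^esub> pres_gen S (coxeter_rels S F l) v
    = \<one>\<^bsub>coxeter_group S F l\<^esub>"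
proof -
  interpret group "coxeter_group S F l" by (simp add: coxeter_group_def group_presented)
  have "([(v, True), (v, True)], []) \<in> coxeter_rels S F l" using assms by (auto simp: coxeter_rels_def)
  from presented_group_rel[OF this, of S] assms pres_gen_closed[OF assms, of "coxeter_rels S F l"]
  show ?thesis by (simp flip: coxeter_group_def)
qed

lemma coxeter_gen_edge:
  assumes "{u, v} \<in> F" "u \<in> S" "v \<in> S"
  shows "(pres_gen S (coxeter_rels S F l) u \<otimes>\<^bsub>coxeter_group S F l\<^esub> pres_gen S (coxeter_rels S F l) v)
    [^]\<^bsub>coxeter_group S F l\<^esub> l {u, v} = \<one>\<^bsub>coxeter_group S F l\<^esub>"
proof -
  interpret group "coxeter_group S F l" by (simp add: coxeter_group_def group_presented)
  have "(concat (replicate (l {u, v}) [(u, True), (v, True)]), []) \<in> coxeter_rels S F l"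
    using assms by (auto simp: coxeter_rels_def)
  moreover have "concat (replicate n [(u, True), (v, True)]) \<in> gwords S" for n
    using assms by (induction n) auto
  ultimately have "word_eval (coxeter_group S F l) (pres_gen S (coxeter_rels S F l))
      (concat (replicate (l {u, v}) [(u, True), (v, True)])) = \<one>\<^bsub>coxeter_group S F l\<^esub>"
    using presented_group_rel[of "concat (replicate (l {u, v}) [(u, True), (v, True)])" "[]"]
    by (simp add: coxeter_group_def)
  then show ?thesis
    using assms pres_gen_closed[of _ S "coxeter_rels S F l"]
    by (simp add: word_eval_concat_replicate flip: coxeter_group_def)
qed

text \<open>\<open>coxeter_rels\<close> has a relation for each order of the endpoints of an edge,
  while \<open>ed\<close> asks for one order of choice; \<open>pow_swap\<close> yields the
  other.\<close>

lemma coxeter_group_universal: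
  assumes "group H" "\<phi> \<in> S \<rightarrow> carrier H"
    and sq: "\<And>v. v \<in> S \<Longrightarrow> \<phi> v \<otimes>\<^bsub>H\<^esub> \<phi> v = \<one>\<^bsub>H\<^esub>"
    and ed: "\<And>e. e \<in> F \<Longrightarrow> \<exists>u\<in>S. \<exists>v\<in>S. e = {u, v} \<and> (\<phi> u \<otimes>\<^bsub>H\<^esub> \<phi> v) [^]\<^bsub>H\<^esub> l e = \<one>\<^bsub>H\<^esub>"
  shows "\<exists>h\<in>hom (coxeter_group S F l) H. \<forall>v\<in>S. h (pres_gen S (coxeter_rels S F l) v) = \<phi> v"
proof -
  interpret H: group H by fact
  have "word_eval H \<phi> r = word_eval H \<phi> r'" if "(r, r') \<in> coxeter_rels S F l" for r r'
    using that unfolding coxeter_rels_def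
  proof (elim UnE CollectE exE conjE Pair_inject)
    fix v assume "r = [(v, True), (v, True)]" "r' = []" "v \<in> S"
    then show ?thesis using sq[of v] assms(2) by (simp add: Pi_iff)
  next
    fix u v assume r: "r = concat (replicate (l {u, v}) [(u, True), (v, True)])" "r' = []" "{u, v} \<in> F"
    obtain u' v' where uv': "u' \<in> S" "v' \<in> S" "{u, v} = {u', v'}"
      and eq: "(\<phi> u' \<otimes>\<^bsub>H\<^esub> \<phi> v') [^]\<^bsub>H\<^esub> l {u, v} = \<one>\<^bsub>H\<^esub>"
      using ed[OF r(3)] by blast
    have cl: "\<phi> u' \<in> carrier H" "\<phi> v' \<in> carrier H" using assms(2) uv' by auto
    then have "(\<phi> v' \<otimes>\<^bsub>H\<^esub> \<phi> u') [^]\<^bsub>H\<^esub> l {u, v} = \<one>\<^bsub>H\<^esub>"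
      using H.pow_swap[of "\<phi> u'" "\<phi> v'" "l {u, v}"] eq by simp
    then have "(\<phi> u \<otimes>\<^bsub>H\<^esub> \<phi> v) [^]\<^bsub>H\<^esub> l {u, v} = \<one>\<^bsub>H\<^esub>" "\<phi> u \<in> carrier H" "\<phi> v \<in> carrier H"
      using eq uv'(3) cl by (auto simp: doubleton_eq_iff insert_commute)
    then show ?thesis using r by (simp add: H.word_eval_concat_replicate)
  qed
  from presented_group_universal[OF assms(1,2) this]
  show ?thesis unfolding coxeter_group_def by blast
qed

lemma (in group) commute_mult:
  assumes "x \<in> carrier G" "y \<in> carrier G" "z \<in> carrier G"
    and "x \<otimes> z = z \<otimes> x" "y \<otimes> z = z \<otimes> y"
  shows "(x \<otimes> y) \<otimes> z = z \<otimes> (x \<otimes> y)"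
proof -
  have "(x \<otimes> y) \<otimes> z = (x \<otimes> z) \<otimes> y"
    using assms(1-3,5) by (simp add: m_assoc)
  also have "\<dots> = z \<otimes> (x \<otimes> y)"
    unfolding assms(4) using assms(1-3) by (simp add: m_assoc)
  finally show ?thesis .
qed

lemma (in group) square_mult_eq_one:
  assumes "x \<in> carrier G" "y \<in> carrier G" "x \<otimes> x = \<one>" "y \<otimes> y = \<one>" "x \<otimes> y = y \<otimes> x"
  shows "(x \<otimes> y) [^] (2::nat) = \<one>"
proof -
  have "(x \<otimes> y) [^] (2::nat) = x \<otimes> (y \<otimes> x) \<otimes> y"
    using assms(1,2) by (simp add: numeral_2_eq_2 m_assoc)
  also have "\<dots> = (x \<otimes> x) \<otimes> (y \<otimes> y)"
    using assms(1,2) by (simp add: m_assoc flip: assms(5))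
  finally show ?thesis using assms by simp
qed

section \<open>The two mutually inverse homomorphisms\<close>

text \<open>Finiteness enters through \<open>dyer_action_hom\<close> and through
  \<open>Z2_power_induct\<close>, by which the units generate \<open>Z2_power I\<close>.\<close>

locale finite_dyer_graph = dyer_graph +
  assumes finite_V: "finite V"
begin

abbreviation "LV \<equiv> Lambda_verts V f"
abbreviation "LE \<equiv> Lambda_edges V E f"
abbreviation "lab \<equiv> Lambda_label f m"
abbreviation "W \<equiv> coxeter_group LV LE lab"
abbreviation "cox_gen \<equiv> pres_gen LV (coxeter_rels LV LE lab)"
abbreviation "Z \<equiv> Z2_power I"
abbreviation "act \<equiv> dyer_action V E f m"
abbreviation "SD \<equiv> semidirect D Z act"

sublocale W: group W
  by (simp add: coxeter_group_def group_presented)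

sublocale Z: group Z
  by (rule group_Z2_power)

sublocale SD: group SD
  by (intro group_semidirect D.is_group Z.is_group dyer_action_hom finite_V)

lemma finite_I: "finite I"
  using finite_V I_ge3 by (meson finite_subset subsetI)

lemma I_subset: "v \<in> I \<Longrightarrow> v \<in> V"
  using I_ge3 by blast

lemma f_eq_2: "v \<in> V \<Longrightarrow> v \<notin> I \<Longrightarrow> f v = 2"
  by (auto simp: V_p_def V_two_def V_inf_def)

lemma label_eq_2: "{u, v} \<in> E \<Longrightarrow> u \<in> I \<or> v \<in> I \<Longrightarrow> m {u, v} = 2"
  using m_eq2[of u v] m_eq2[of v u] I_ge3 by (auto simp: insert_commute)

lemma edge_neq: "{u, v} \<in> E \<Longrightarrow> u \<noteq> v"
  using graph by (auto simp: simplicial_graph_def)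

lemma Lambda_verts_simps [simp]: "Inl v \<in> LV \<longleftrightarrow> v \<in> V" "Inr v \<in> LV \<longleftrightarrow> v \<in> I"
  by (auto simp: Lambda_verts_def)

lemma cox_gen_closed [simp]: "s \<in> LV \<Longrightarrow> cox_gen s \<in> carrier W"
  by (simp add: coxeter_group_def pres_gen_closed)

lemma cox_gen_square: "s \<in> LV \<Longrightarrow> cox_gen s \<otimes>\<^bsub>W\<^esub> cox_gen s = \<one>\<^bsub>W\<^esub>"
  by (rule coxeter_gen_square)

lemma cox_gen_edge:
  assumes "{u, v} \<in> E"
  shows "(cox_gen (Inl u) \<otimes>\<^bsub>W\<^esub> cox_gen (Inl v)) [^]\<^bsub>W\<^esub> m {u, v} = \<one>\<^bsub>W\<^esub>"
proof -
  have "{Inl u, Inl v} \<in> LE" using assms by (auto simp: Lambda_edges_def)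
  from coxeter_gen_edge[OF this, of LV lab] show ?thesis
    using edge_verts[OF assms] by (simp add: Lambda_label_simps)
qed

lemma cox_gen_order:
  assumes "v \<in> V_p V f"
  shows "(cox_gen (Inl v) \<otimes>\<^bsub>W\<^esub> cox_gen (Inr v)) [^]\<^bsub>W\<^esub> the_enat (f v) = \<one>\<^bsub>W\<^esub>"
proof -
  have "{Inl v, Inr v} \<in> LE" using assms by (auto simp: Lambda_edges_def)
  from coxeter_gen_edge[OF this, of LV lab] show ?thesis
    using assms I_subset[of v] by (simp add: Lambda_label_simps)
qed

text \<open>The vertex \<open>Inr u\<close> is joined to every vertex other than itself and
  \<open>Inl u\<close> by an edge labelled 2, and this label means commutation of
  involutions.\<close>

lemma cox_gen_Inr_commute:
  assumes "u \<in> I" "s \<in> LV" "s \<noteq> Inl u"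
  shows "cox_gen (Inr u) \<otimes>\<^bsub>W\<^esub> cox_gen s = cox_gen s \<otimes>\<^bsub>W\<^esub> cox_gen (Inr u)"
proof (cases "s = Inr u")
  case False
  then have "{Inr u, s} \<in> LE" using assms unfolding Lambda_edges_def by blast
  from coxeter_gen_edge[OF this, of LV lab]
  have "(cox_gen (Inr u) \<otimes>\<^bsub>W\<^esub> cox_gen s) [^]\<^bsub>W\<^esub> (2::nat) = \<one>\<^bsub>W\<^esub>"
    using assms by (simp add: Lambda_label_simps)
  then show ?thesis using assms by (intro W.commute_if_square_eq_one) (auto simp: cox_gen_square)
qed simp

section \<open>Images of the Dyer generators in the Coxeter group\<close>

definition rotation :: "'a \<Rightarrow> ('a + 'a) gword set"
  where "rotation v = (if v \<in> I then cox_gen (Inl v) \<otimes>\<^bsub>W\<^esub> cox_gen (Inr v) else cox_gen (Inl v))"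

lemma rotation_closed [simp]: "v \<in> V \<Longrightarrow> rotation v \<in> carrier W"
  by (simp add: rotation_def)

text \<open>No factor of \<open>rotation v\<close> is \<open>cox_gen (Inl u)\<close>, the one
  generator that \<open>cox_gen_Inr_commute\<close> excludes.\<close>

lemma rotation_commute:
  assumes "v \<in> V" "u \<in> I" "u \<noteq> v"
  shows "rotation v \<otimes>\<^bsub>W\<^esub> cox_gen (Inr u) = cox_gen (Inr u) \<otimes>\<^bsub>W\<^esub> rotation v"
proof -
  have "cox_gen (Inl v) \<otimes>\<^bsub>W\<^esub> cox_gen (Inr u) = cox_gen (Inr u) \<otimes>\<^bsub>W\<^esub> cox_gen (Inl v)"
    using cox_gen_Inr_commute[of u "Inl v"] assms by simp
  moreover have "cox_gen (Inr v) \<otimes>\<^bsub>W\<^esub> cox_gen (Inr u) = cox_gen (Inr u) \<otimes>\<^bsub>W\<^esub> cox_gen (Inr v)" if "v \<in> I"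
    using cox_gen_Inr_commute[of u "Inr v"] assms that by simp
  ultimately show ?thesis
    using assms I_subset by (cases "v \<in> I") (simp_all add: rotation_def W.commute_mult del: Un_iff)
qed

text \<open>The power relation comes from the edge \<open>{Inl v, Inr v}\<close> if
  \<open>v \<in> I\<close>, and from the involution \<open>cox_gen (Inl v)\<close> otherwise. The
  braid relation is a commutation as soon as one end lies in \<open>I\<close>; if none does, it is
  the Coxeter relation in braid form.\<close>

lemma rotation_rels:
  assumes "(r, r') \<in> dyer_rels V E f m"
  shows "word_eval W rotation r = word_eval W rotation r'"
  using assms unfolding dyer_rels_def
proof (elim UnE CollectE exE conjE Pair_inject)
  fix v assume r: "r = replicate (the_enat (f v)) (v, True)" "r' = []" and v: "v \<in> V" "f v \<noteq> \<infinity>"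
  have "rotation v [^]\<^bsub>W\<^esub> the_enat (f v) = \<one>\<^bsub>W\<^esub>"
  proof (cases "v \<in> I")
    case True
    then have "v \<in> V_p V f" using v by (auto simp: V_inf_def)
    then show ?thesis using cox_gen_order by (simp add: rotation_def)
  next
    case False
    then have "f v = 2" using f_eq_2 v by simp
    then show ?thesis using False v
      by (simp add: rotation_def numeral_eq_enat) (simp add: numeral_2_eq_2 cox_gen_square)
  qed
  then show ?thesis using r v by (simp add: W.word_eval_replicate)
next
  fix u v assume r: "r = alternating (v, True) (u, True) (m {u, v})"
    "r' = alternating (u, True) (v, True) (m {u, v})" and e: "{u, v} \<in> E"
  have uv: "u \<in> V" "v \<in> V" "u \<noteq> v" using edge_verts edge_neq e by auto
  show ?thesis
  proof (cases "u \<in> I \<or> v \<in> I")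
    case True
    then have m: "m {u, v} = 2" using label_eq_2 e by simp
    have "cox_gen (Inl u) \<otimes>\<^bsub>W\<^esub> cox_gen (Inl v) = cox_gen (Inl v) \<otimes>\<^bsub>W\<^esub> cox_gen (Inl u)"
      using cox_gen_edge[OF e] uv by (intro W.commute_if_square_eq_one) (simp_all add: m cox_gen_square)
    moreover have "cox_gen (Inr u) \<otimes>\<^bsub>W\<^esub> cox_gen (Inl v) = cox_gen (Inl v) \<otimes>\<^bsub>W\<^esub> cox_gen (Inr u)" if "u \<in> I"
      using cox_gen_Inr_commute[of u "Inl v"] that uv by simp
    \<comment> \<open>Every factor of \<open>rotation u\<close> commutes with
      \<open>cox_gen (Inl v)\<close>: the first by the label 2 of the old edge, the possible second
      by \<open>cox_gen_Inr_commute\<close>.\<close>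
    ultimately have *: "rotation u \<otimes>\<^bsub>W\<^esub> cox_gen (Inl v) = cox_gen (Inl v) \<otimes>\<^bsub>W\<^esub> rotation u"
      using uv by (cases "u \<in> I") (simp_all add: rotation_def W.commute_mult del: Un_iff)
    have "rotation v \<otimes>\<^bsub>W\<^esub> rotation u = rotation u \<otimes>\<^bsub>W\<^esub> rotation v"
    proof (cases "v \<in> I")
      case True
      \<comment> \<open>\<open>rotation u\<close> commutes with the first factor by \<open>*\<close>
        and with the second by \<open>rotation_commute\<close>.\<close>
      have "(cox_gen (Inl v) \<otimes>\<^bsub>W\<^esub> cox_gen (Inr v)) \<otimes>\<^bsub>W\<^esub> rotation u
          = rotation u \<otimes>\<^bsub>W\<^esub> (cox_gen (Inl v) \<otimes>\<^bsub>W\<^esub> cox_gen (Inr v))"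
        using uv True * rotation_commute[of u v] by (intro W.commute_mult) auto
      then show ?thesis using True by (simp add: rotation_def[of v])
    next
      case False
      then show ?thesis using * by (simp add: rotation_def[of v])
    qed
    then show ?thesis using uv by (simp add: r m numeral_2_eq_2)
  next
    case False
    then have "rotation u = cox_gen (Inl u)" "rotation v = cox_gen (Inl v)"
      by (simp_all add: rotation_def)
    then show ?thesis
      using cox_gen_edge[OF e] uv W.word_eval_alternating_eq_iff[of rotation u v "m {u, v}"]
      by (simp add: r cox_gen_square)
  qed
qed

lemma dyer_to_coxeter: "\<exists>a\<in>hom D W. \<forall>v\<in>V. a (gen v) = rotation v"
proof -
  have "rotation \<in> V \<rightarrow> carrier W" by simp
  from ex1_implies_ex[OF presented_group_universal[OF W.is_group this rotation_rels]]
  obtain a where "a \<in> hom D W \<and> a \<in> extensional (carrier D) \<and> (\<forall>v\<in>V. a (gen v) = rotation v)"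
    unfolding dyer_group_def dyer_gen_def by (rule exE)
  then show ?thesis by (intro bexI[of _ a]) simp_all
qed

lemma Z2_to_coxeter: "\<exists>b\<in>hom Z W. \<forall>v\<in>I. b (Z2_unit I v) = cox_gen (Inr v)"
proof (rule W.Z2_power_hom_exists[OF finite_I])
  fix u v assume "u \<in> I" "v \<in> I"
  then show "cox_gen (Inr u) \<otimes>\<^bsub>W\<^esub> cox_gen (Inr v) = cox_gen (Inr v) \<otimes>\<^bsub>W\<^esub> cox_gen (Inr u)"
    by (intro cox_gen_Inr_commute) simp_all
qed (simp_all add: cox_gen_square)

section \<open>Comparison on generators and the action on \<open>D\<close>\<close>

lemma gen_hom_cong:
  assumes "group H" "h \<in> hom D H" "h' \<in> hom D H"
    and "\<And>v. v \<in> V \<Longrightarrow> h (gen v) = h' (gen v)" "x \<in> carrier D"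
  shows "h x = h' x"
  using pres_class_hom_cong[of H h V "dyer_rels V E f m" h' x] assms
  by (simp add: dyer_group_def dyer_gen_def)

lemma cox_gen_hom_cong:
  assumes "group H" "h \<in> hom W H" "h' \<in> hom W H"
    and "\<And>s. s \<in> LV \<Longrightarrow> h (cox_gen s) = h' (cox_gen s)" "x \<in> carrier W"
  shows "h x = h' x"
  using pres_class_hom_cong[of H h LV "coxeter_rels LV LE lab" h' x] assms
  by (simp add: coxeter_group_def)

lemma act_auto: "g \<in> carrier Z \<Longrightarrow> act g \<in> auto D"
  using hom_in_carrier[OF dyer_action_hom[OF finite_V]] by (simp add: carrier_AutoGroup)

lemma act_hom: "g \<in> carrier Z \<Longrightarrow> act g \<in> hom D D"
  using act_auto by (simp add: auto_def)

lemma act_closed [simp]: "g \<in> carrier Z \<Longrightarrow> x \<in> carrier D \<Longrightarrow> act g x \<in> carrier D"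
  by (rule hom_in_carrier[OF act_hom])

lemma act_one_right [simp]: "g \<in> carrier Z \<Longrightarrow> act g \<one>\<^bsub>D\<^esub> = \<one>\<^bsub>D\<^esub>"
  by (rule hom_one[OF act_hom D.is_group D.is_group])

lemma act_one_left [simp]: "x \<in> carrier D \<Longrightarrow> act \<one>\<^bsub>Z\<^esub> x = x"
  using hom_one[OF dyer_action_hom[OF finite_V] Z.is_group D.AutoGroup]
  by (simp add: one_AutoGroup)

lemma act_mult:
  assumes "g \<in> carrier Z" "h \<in> carrier Z" "x \<in> carrier D"
  shows "act (g \<otimes>\<^bsub>Z\<^esub> h) x = act g (act h x)"
  using hom_mult[OF dyer_action_hom[OF finite_V] assms(1,2)] act_auto assms
  by (simp add: mult_AutoGroup compose_def)

lemma act_unit_gen: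
  assumes "v \<in> I" "u \<in> V"
  shows "act (Z2_unit I v) (gen u) = (if u = v then inv\<^bsub>D\<^esub> (gen u) else gen u)"
  using assms dyer_action_apply_gen[OF finite_V Z2_unit_closed assms(2), of v]
  by (cases "u = v") (simp_all add: Z2_unit_def del: Un_iff)

text \<open>Conjugation by the involution \<open>cox_gen (Inr v)\<close> after \<open>a\<close>, and
  \<open>a\<close> after the action of the unit, are two homomorphisms from \<open>D\<close> to
  \<open>W\<close>, so comparing them on the \<open>gen u\<close> is enough.\<close>

lemma twist_unit:
  assumes a: "a \<in> hom D W" "\<And>v. v \<in> V \<Longrightarrow> a (gen v) = rotation v"
    and v: "v \<in> I" and x: "x \<in> carrier D"
  shows "cox_gen (Inr v) \<otimes>\<^bsub>W\<^esub> a x = a (act (Z2_unit I v) x) \<otimes>\<^bsub>W\<^esub> cox_gen (Inr v)"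
proof -
  let ?t = "cox_gen (Inr v)"
  have t: "?t \<in> carrier W" "?t \<otimes>\<^bsub>W\<^esub> ?t = \<one>\<^bsub>W\<^esub>" using v by (auto simp: cox_gen_square)
  have tt: "?t \<otimes>\<^bsub>W\<^esub> (?t \<otimes>\<^bsub>W\<^esub> z) = z" if "z \<in> carrier W" for z
    using t that by (simp flip: W.m_assoc)
  note cl = hom_in_carrier[OF a(1)]
  \<comment> \<open>\<open>?t\<close> is its own inverse, so this is a conjugate of
    \<open>a\<close>; the two inner copies of \<open>?t\<close> cancel in a product.\<close>
  have h1: "(\<lambda>x. ?t \<otimes>\<^bsub>W\<^esub> a x \<otimes>\<^bsub>W\<^esub> ?t) \<in> hom D W"
    by (rule homI) (use t in \<open>simp_all add: cl W.m_assoc tt hom_mult[OF a(1)]\<close>)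
  have h2: "(\<lambda>x. a (act (Z2_unit I v) x)) \<in> hom D W"
    using hom_compose[OF act_hom[OF Z2_unit_closed] a(1)] by (simp add: comp_def)
  have "?t \<otimes>\<^bsub>W\<^esub> a x \<otimes>\<^bsub>W\<^esub> ?t = a (act (Z2_unit I v) x)"
  proof (rule gen_hom_cong[OF W.is_group h1 h2 _ x])
    fix u assume u: "u \<in> V"
    show "?t \<otimes>\<^bsub>W\<^esub> a (gen u) \<otimes>\<^bsub>W\<^esub> ?t = a (act (Z2_unit I v) (gen u))"
    proof (cases "u = v")
      case True
      let ?y = "cox_gen (Inl v)"
      have y: "?y \<in> carrier W" "?y \<otimes>\<^bsub>W\<^esub> ?y = \<one>\<^bsub>W\<^esub>" using u True by (auto simp: cox_gen_square)
      \<comment> \<open>The unit inverts \<open>gen v\<close>, and the inverse of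
        \<open>?y ?t\<close> is \<open>?t ?y\<close>, which equals
        \<open>?t (?y ?t) ?t\<close>.\<close>
      have "a (act (Z2_unit I v) (gen u)) = inv\<^bsub>W\<^esub> (?y \<otimes>\<^bsub>W\<^esub> ?t)"
        using True u v a by (simp add: act_unit_gen group_hom.hom_inv[of D W a] group_hom_def
            group_hom_axioms_def rotation_def)
      also have "\<dots> = ?t \<otimes>\<^bsub>W\<^esub> ?y"
        using y t by (simp add: W.inv_mult_group W.inv_equality)
      also have "\<dots> = ?t \<otimes>\<^bsub>W\<^esub> a (gen u) \<otimes>\<^bsub>W\<^esub> ?t"
        using True u v t y by (simp add: a(2) rotation_def W.m_assoc)
      finally show ?thesis by simp
    next
      case False
      then show ?thesis using u v t rotation_commute[of u v]
        by (simp add: act_unit_gen a(2) W.m_assoc) (simp add: tt)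
    qed
  qed
  \<comment> \<open>Right multiplication by \<open>?t\<close> undoes half of the
    conjugation.\<close>
  from this[symmetric] show ?thesis using t x by (simp add: cl W.m_assoc)
qed

text \<open>The relation passes from units to products since both \<open>b\<close> and
  \<open>act\<close> are multiplicative. It is the compatibility that \<open>hom_semidirectI\<close>
  asks for.\<close>

lemma twist:
  assumes a: "a \<in> hom D W" "\<And>v. v \<in> V \<Longrightarrow> a (gen v) = rotation v"
    and b: "b \<in> hom Z W" "\<And>v. v \<in> I \<Longrightarrow> b (Z2_unit I v) = cox_gen (Inr v)"
    and "x \<in> carrier D" and g: "g \<in> carrier Z"
  shows "b g \<otimes>\<^bsub>W\<^esub> a x = a (act g x) \<otimes>\<^bsub>W\<^esub> b g"
  using finite_I g
proof (induction rule: Z2_power_induct)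
  case one
  show ?case using assms hom_one[OF b(1) Z.is_group W.is_group] by (simp add: hom_in_carrier[OF a(1)])
next
  case (unit v g)
  note cl = hom_in_carrier[OF a(1)] hom_in_carrier[OF b(1)]
  have "b (Z2_unit I v \<otimes>\<^bsub>Z\<^esub> g) \<otimes>\<^bsub>W\<^esub> a x = cox_gen (Inr v) \<otimes>\<^bsub>W\<^esub> (b g \<otimes>\<^bsub>W\<^esub> a x)"
    using unit assms(5) by (simp add: hom_mult[OF b(1)] b(2) W.m_assoc cl)
  also have "\<dots> = (cox_gen (Inr v) \<otimes>\<^bsub>W\<^esub> a (act g x)) \<otimes>\<^bsub>W\<^esub> b g"
    using unit assms(5) by (simp add: W.m_assoc cl)
  \<comment> \<open>\<open>twist_unit\<close> is applied to \<open>act g x\<close>, so the two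
    actions compose to that of the product.\<close>
  also have "\<dots> = a (act (Z2_unit I v \<otimes>\<^bsub>Z\<^esub> g) x) \<otimes>\<^bsub>W\<^esub> b (Z2_unit I v \<otimes>\<^bsub>Z\<^esub> g)"
    using unit assms(5) twist_unit[OF a unit(1), of "act g x"]
    by (simp add: act_mult hom_mult[OF b(1)] b(2) W.m_assoc cl)
  finally show ?case .
qed

section \<open>Images of the Coxeter generators in the semidirect product\<close>

definition sd_gen :: "'a + 'a \<Rightarrow> 'a gword set \<times> ('a \<Rightarrow> int)"
  where "sd_gen s = (case s of
      Inl v \<Rightarrow> (gen v, if v \<in> I then Z2_unit I v else \<one>\<^bsub>Z\<^esub>)
    | Inr v \<Rightarrow> (\<one>\<^bsub>D\<^esub>, Z2_unit I v))"

lemma sd_gen_simps: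
  "v \<in> I \<Longrightarrow> sd_gen (Inl v) = (gen v, Z2_unit I v)"
  "v \<notin> I \<Longrightarrow> sd_gen (Inl v) = (gen v, \<one>\<^bsub>Z\<^esub>)"
  "sd_gen (Inr v) = (\<one>\<^bsub>D\<^esub>, Z2_unit I v)"
  by (simp_all add: sd_gen_def)

lemma sd_gen_closed [simp]: "s \<in> LV \<Longrightarrow> sd_gen s \<in> carrier SD"
  by (cases s) (auto simp: sd_gen_def semidirect_simps)

lemma gen_order:
  assumes "v \<in> V" "f v \<noteq> \<infinity>"
  shows "gen v [^]\<^bsub>D\<^esub> the_enat (f v) = \<one>\<^bsub>D\<^esub>"
proof -
  have "(replicate (the_enat (f v)) (v, True), []) \<in> dyer_rels V E f m"
    unfolding dyer_rels_def using assms by blast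
  from rels_hold[OF this] show ?thesis using assms by (simp add: D.word_eval_replicate)
qed

lemma gen_square: "v \<in> V \<Longrightarrow> v \<notin> I \<Longrightarrow> gen v \<otimes>\<^bsub>D\<^esub> gen v = \<one>\<^bsub>D\<^esub>"
  using gen_order[of v] f_eq_2[of v] by (simp add: numeral_eq_enat) (simp add: numeral_2_eq_2)

text \<open>For \<open>v \<in> I\<close> the second component inverts \<open>gen v\<close>, so the
  square has first component \<open>gen v\<close> times its inverse, whatever the order of
  \<open>gen v\<close>. Outside \<open>I\<close>, \<open>gen v\<close> itself is an
  involution.\<close>

lemma sd_gen_square: "s \<in> LV \<Longrightarrow> sd_gen s \<otimes>\<^bsub>SD\<^esub> sd_gen s = \<one>\<^bsub>SD\<^esub>"
proof (cases s)
  case (Inl v)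
  assume "s \<in> LV"
  then have v: "v \<in> V" using Inl by simp
  then show ?thesis using Inl
    by (cases "v \<in> I")
      (simp_all add: sd_gen_simps semidirect_simps act_unit_gen Z2_unit_square gen_square)
qed (simp_all add: sd_gen_simps semidirect_simps Z2_unit_square)

text \<open>The unit of \<open>u\<close> fixes \<open>gen v\<close> for \<open>v \<noteq> u\<close>,
  and the second components commute.\<close>

lemma sd_gen_commute:
  assumes "u \<in> I" "s \<in> LV" "s \<noteq> Inl u"
  shows "sd_gen (Inr u) \<otimes>\<^bsub>SD\<^esub> sd_gen s = sd_gen s \<otimes>\<^bsub>SD\<^esub> sd_gen (Inr u)"
proof (cases s)
  case (Inl v)
  then have "v \<in> V" "v \<noteq> u" using assms by auto
  then show ?thesis using assms(1) Inl
    by (cases "v \<in> I") (simp_all add: sd_gen_simps semidirect_simps act_unit_gen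
        Z2_power_commute[of _ _ "Z2_unit I u"])
qed (use assms in \<open>simp add: sd_gen_simps semidirect_simps Z2_power_commute[of _ _ "Z2_unit I u"]\<close>)

lemma embed_D: "(\<lambda>x. (x, \<one>\<^bsub>Z\<^esub>)) \<in> hom D SD"
  by (rule homI) (simp_all add: semidirect_simps)

lemma embed_Z: "(\<lambda>g. (\<one>\<^bsub>D\<^esub>, g)) \<in> hom Z SD"
  by (rule homI) (simp_all add: semidirect_simps)

lemma embed_D_pow: "x \<in> carrier D \<Longrightarrow> (x, \<one>\<^bsub>Z\<^esub>) [^]\<^bsub>SD\<^esub> (n::nat) = (x [^]\<^bsub>D\<^esub> n, \<one>\<^bsub>Z\<^esub>)"
  using hom_nat_pow[OF embed_D _ D.is_group SD.is_group, of x n] by simp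

text \<open>The two units cancel, so the order relation of the edge \<open>{Inl v, Inr v}\<close>
  becomes that of \<open>gen v\<close> in \<open>D\<close>.\<close>

lemma sd_gen_mult_Inr:
  assumes "v \<in> I"
  shows "sd_gen (Inl v) \<otimes>\<^bsub>SD\<^esub> sd_gen (Inr v) = (gen v, \<one>\<^bsub>Z\<^esub>)"
  using assms I_subset[OF assms] by (simp add: sd_gen_simps semidirect_simps Z2_unit_square)

lemma sd_gen_edge:
  assumes e: "{u, v} \<in> E"
  shows "(sd_gen (Inl u) \<otimes>\<^bsub>SD\<^esub> sd_gen (Inl v)) [^]\<^bsub>SD\<^esub> m {u, v} = \<one>\<^bsub>SD\<^esub>"
proof -
  have uv: "u \<in> V" "v \<in> V" "u \<noteq> v" using edge_verts edge_neq e by auto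
  have "(alternating (v, True) (u, True) (m {u, v}), alternating (u, True) (v, True) (m {u, v}))
      \<in> dyer_rels V E f m"
    using e by (auto simp: dyer_rels_def)
  note rel = rels_hold[OF this]
  show ?thesis
  proof (cases "u \<in> I \<or> v \<in> I")
    case True
    then have m: "m {u, v} = 2" using label_eq_2 e by simp
    have comm: "gen v \<otimes>\<^bsub>D\<^esub> gen u = gen u \<otimes>\<^bsub>D\<^esub> gen v"
      using rel uv by (simp add: m numeral_2_eq_2)
    \<comment> \<open>As \<open>u \<noteq> v\<close>, each unit acts trivially on the other
      generator, so \<open>comm\<close> and commutativity of \<open>Z\<close> suffice.\<close>
    have "sd_gen (Inl u) \<otimes>\<^bsub>SD\<^esub> sd_gen (Inl v) = sd_gen (Inl v) \<otimes>\<^bsub>SD\<^esub> sd_gen (Inl u)"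
      using uv comm
      by (cases "u \<in> I"; cases "v \<in> I")
        (simp_all add: sd_gen_simps semidirect_simps act_unit_gen Z2_power_commute[of _ _ "Z2_unit I u"])
    then show ?thesis unfolding m
      using uv by (intro SD.square_mult_eq_one) (auto simp: sd_gen_square)
  next
    case False
    \<comment> \<open>Both generators are involutions here, so the braid relation is a power
      relation. It comes with \<open>v\<close> first; \<open>pow_swap\<close> then restores the
      order of the claim.\<close>
    have "(gen v \<otimes>\<^bsub>D\<^esub> gen u) [^]\<^bsub>D\<^esub> m {u, v} = \<one>\<^bsub>D\<^esub>"
      using rel uv False by (subst (asm) D.word_eval_alternating_eq_iff) (auto simp: gen_square)
    then have "(gen u \<otimes>\<^bsub>D\<^esub> gen v) [^]\<^bsub>D\<^esub> m {u, v} = \<one>\<^bsub>D\<^esub>"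
      using D.pow_swap[of "gen v" "gen u" "m {u, v}"] uv by simp
    then show ?thesis using False uv by (simp add: sd_gen_simps semidirect_simps embed_D_pow)
  qed
qed

text \<open>Three families of edges are checked: those of the Dyer graph by
  \<open>sd_gen_edge\<close>, those labelled 2 at some \<open>Inr u\<close> by commutation, and
  \<open>{Inl u, Inr u}\<close> by the finite order of \<open>gen u\<close>.\<close>

lemma coxeter_to_semidirect: "\<exists>h\<in>hom W SD. \<forall>s\<in>LV. h (cox_gen s) = sd_gen s"
proof (rule coxeter_group_universal[OF SD.is_group])
  fix e assume "e \<in> LE"
  then consider (old) u v where "e = {Inl u, Inl v}" "{u, v} \<in> E"
    | (two) u s where "e = {Inr u, s}" "u \<in> I" "s \<in> LV" "s \<noteq> Inl u"
    | (order) u where "e = {Inl u, Inr u}" "u \<in> V_p V f"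
    unfolding Lambda_edges_def by blast
  then show "\<exists>u\<in>LV. \<exists>v\<in>LV. e = {u, v} \<and> (sd_gen u \<otimes>\<^bsub>SD\<^esub> sd_gen v) [^]\<^bsub>SD\<^esub> lab e = \<one>\<^bsub>SD\<^esub>"
  proof cases
    case old
    then show ?thesis using edge_verts[OF old(2)] sd_gen_edge[OF old(2)]
      by (intro bexI[of _ "Inl u"] bexI[of _ "Inl v"]) (auto simp: Lambda_label_simps)
  next
    case two
    have "(sd_gen (Inr u) \<otimes>\<^bsub>SD\<^esub> sd_gen s) [^]\<^bsub>SD\<^esub> (2::nat) = \<one>\<^bsub>SD\<^esub>"
      using two sd_gen_commute[OF two(2,3,4)] by (intro SD.square_mult_eq_one) (simp_all add: sd_gen_square)
    then have "(sd_gen (Inr u) \<otimes>\<^bsub>SD\<^esub> sd_gen s) [^]\<^bsub>SD\<^esub> lab e = \<one>\<^bsub>SD\<^esub>"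
      by (simp only: two(1) Lambda_label_simps(3)[OF two(4)])
    moreover have "Inr u \<in> LV" using two(2) by simp
    ultimately show ?thesis using two(1,3) by blast
  next
    case order
    then have u: "u \<in> I" "u \<in> V" "f u \<noteq> \<infinity>" by (auto simp: V_p_def V_inf_def)
    then have "(sd_gen (Inl u) \<otimes>\<^bsub>SD\<^esub> sd_gen (Inr u)) [^]\<^bsub>SD\<^esub> lab e = \<one>\<^bsub>SD\<^esub>"
      using order(1) by (simp add: Lambda_label_simps sd_gen_mult_Inr embed_D_pow gen_order semidirect_simps)
    moreover have "Inl u \<in> LV" "Inr u \<in> LV" using u by simp_all
    ultimately show ?thesis using order(1) by blast
  qed
qed (simp_all add: sd_gen_square)

section \<open>The isomorphism\<close>

lemma coxeter_iso_semidirect: "W \<cong> SD"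
proof -
  obtain a where a: "a \<in> hom D W" "\<And>v. v \<in> V \<Longrightarrow> a (gen v) = rotation v"
    using dyer_to_coxeter by blast
  obtain b where b: "b \<in> hom Z W" "\<And>v. v \<in> I \<Longrightarrow> b (Z2_unit I v) = cox_gen (Inr v)"
    using Z2_to_coxeter by blast
  obtain h where h: "h \<in> hom W SD" "\<And>s. s \<in> LV \<Longrightarrow> h (cox_gen s) = sd_gen s"
    using coxeter_to_semidirect by blast
  define k where "k = (\<lambda>(x, g). a x \<otimes>\<^bsub>W\<^esub> b g)"
  have k: "k \<in> hom SD W"
    unfolding k_def using twist[OF a b]
    by (intro hom_semidirectI D.is_group Z.is_group W.is_group dyer_action_hom finite_V a(1) b(1))
  note one = hom_one[OF a(1) D.is_group W.is_group] hom_one[OF b(1) Z.is_group W.is_group]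
  have kh: "k (h x) = x" if "x \<in> carrier W" for x
  proof (rule cox_gen_hom_cong[OF W.is_group _ _ _ that])
    show "(\<lambda>x. k (h x)) \<in> hom W W" using hom_compose[OF h(1) k] by (simp add: comp_def)
    show "(\<lambda>x. x) \<in> hom W W" by (simp add: hom_def)
    fix s assume s: "s \<in> LV"
    show "k (h (cox_gen s)) = cox_gen s"
    proof (cases s)
      case (Inl v)
      \<comment> \<open>The left side is the value of \<open>k\<close> at
        \<open>(gen v, Z2_unit I v)\<close>, the image of \<open>cox_gen (Inl v)\<close> under
        \<open>h\<close>.\<close>
      have "cox_gen (Inl v) \<otimes>\<^bsub>W\<^esub> cox_gen (Inr v) \<otimes>\<^bsub>W\<^esub> cox_gen (Inr v) = cox_gen (Inl v)" if "v \<in> I"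
        using s that Inl by (simp add: W.m_assoc cox_gen_square)
      then show ?thesis using s Inl
        by (cases "v \<in> I") (simp_all add: h(2) sd_gen_simps k_def a(2) b(2) one rotation_def)
    next
      case (Inr v)
      then show ?thesis using s by (simp add: h(2) sd_gen_simps k_def b(2) one)
    qed
  qed
  have ha: "h (a x) = (x, \<one>\<^bsub>Z\<^esub>)" if "x \<in> carrier D" for x
  proof (rule gen_hom_cong[OF SD.is_group _ embed_D _ that])
    show "(\<lambda>x. h (a x)) \<in> hom D SD" using hom_compose[OF a(1) h(1)] by (simp add: comp_def)
    show "h (a (gen v)) = (gen v, \<one>\<^bsub>Z\<^esub>)" if "v \<in> V" for v
      using that by (cases "v \<in> I")
        (simp_all add: a(2) rotation_def hom_mult[OF h(1)] h(2) sd_gen_simps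
          semidirect_simps Z2_unit_square)
  qed
  have hb: "h (b g) = (\<one>\<^bsub>D\<^esub>, g)" if "g \<in> carrier Z" for g
  proof (rule Z2_power_hom_cong[OF finite_I SD.is_group _ embed_Z _ that])
    show "(\<lambda>g. h (b g)) \<in> hom Z SD" using hom_compose[OF b(1) h(1)] by (simp add: comp_def)
  qed (simp add: b(2) h(2) sd_gen_simps)
  \<comment> \<open>By \<open>ha\<close> and \<open>hb\<close>, \<open>h\<close> maps
    \<open>a x\<close> and \<open>b g\<close> to the embedded factors \<open>(x, 1)\<close> and
    \<open>(1, g)\<close>, whose product is \<open>(x, g)\<close>.\<close>
  have hk: "h (k y) = y" if "y \<in> carrier SD" for y
    using that
    by (auto simp: semidirect_simps k_def hom_mult[OF h(1)] hom_in_carrier[OF a(1)]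
        hom_in_carrier[OF b(1)] ha hb)
  have "bij_betw h (carrier W) (carrier SD)"
    by (rule bij_betw_byWitness[where f' = k])
      (use kh hk hom_in_carrier[OF h(1)] hom_in_carrier[OF k] in auto)
  then show ?thesis using h(1) by (auto simp: is_iso_def iso_def)
qed

end

theorem theorem1p1:
  fixes V :: "'a set" and E :: "'a set set" and f :: "'a \<Rightarrow> enat" and m :: "'a set \<Rightarrow> nat"
  assumes "dyer_graph V E f m" and "finite V"
  shows "coxeter_group (Lambda_verts V f) (Lambda_edges V E f) (Lambda_label f m) \<cong>
    semidirect (dyer_group V E f m) (Z2_power (V_p V f \<union> V_inf V f)) (dyer_action V E f m)"
  by (rule finite_dyer_graph.coxeter_iso_semidirect)
    (use assms in \<open>simp add: finite_dyer_graph_def finite_dyer_graph_axioms_def\<close>)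

end
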